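(* Let $(\Omega,\mathcal{F},\mathbb{P})$ be a probability space which does not have atoms and such that $L^2(\Omega,\mathcal{F},\mathbb{P})$ is separable, let $d\ge 1$, and let $\varrho: L^2_d\to\mathbb{R}$ be a functional. Then the following are equivalent: (i) $\varrho$ is a strongly coherent risk measure; (ii) $\varrho$ is a maximal correlation risk measure, i.e. there exists $\mu\in\mathcal{P}_2(\mathbb{R}^d)$ such that $\varrho=\varrho_\mu$.
   Context: $L^2_d$ is the space of ($\mathbb{P}$-a.s. equivalence classes of) $\mathcal{F}$-measurable random vectors $X:\Omega\to\mathbb{R}^d$ with $\mathbb{E}|X|^2<\infty$, with its usual norm. $X\sim Y$ means that $X$ and $Y$ have the same distribution under $\mathbb{P}$, and $X\sim\mu$ means that $X$ has distribution $\mu$. $\mathcal{P}_2(\mathbb{R}^d)$ is the set of Borel probability measures on $\mathbb{R}^d$ with finite second moment. Strongly coherent risk measure: a functional $\varrho:L^2_d\to\mathbb{R}$ that is (a) convex and continuous, and (b) structure neutral: for all $X,Y\in L^2_d$, $$\varrho(X)+\varrho(Y)=\sup\{\varrho(\tilde X+\tilde Y):\ \tilde X,\tilde Y\in L^2_d,\ \tilde X\sim X,\ \tilde Y\sim Y\}.$$ Maximal correlation risk measure with respect to the baseline distribution $\mu\in\mathcal{P}_2(\mathbb{R}^d)$: the functional $\varrho_\mu(X)=\sup\{\mathbb{E}[X\cdot\tilde U]:\ \tilde U\in L^2_d,\ \tilde U\sim\mu\}$, $X\in L^2_d$. *)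

theory Defs
  imports "HOL-Probability.Probability"
begin

text \<open>
  Elements of \<open>L\<^sup>2\<close> are handled through representatives: \<open>L2 M\<close> is the set of
  square-integrable measurable functions, and a map on equivalence classes is a map on
  representatives that satisfies \<open>L2_functional\<close>. Only its values on \<open>L2 M\<close> matter.
  Euclidean-valued functions cover both the scalar space (\<open>'b = real\<close>) and
  random vectors (\<open>'b = real ^ 'n\<close>).
\<close>

definition L2 :: "'a measure \<Rightarrow> ('a \<Rightarrow> 'b::euclidean_space) set" where
  "L2 M = {X \<in> borel_measurable M. integrable M (\<lambda>\<omega>. (norm (X \<omega>))\<^sup>2)}"

definition L2_norm :: "'a measure \<Rightarrow> ('a \<Rightarrow> 'b::euclidean_space) \<Rightarrow> real" where
  "L2_norm M X = sqrt (\<integral>\<omega>. (norm (X \<omega>))\<^sup>2 \<partial>M)"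

definition L2_functional ::
    "'a measure \<Rightarrow> (('a \<Rightarrow> 'b::euclidean_space) \<Rightarrow> real) \<Rightarrow> bool" where
  "L2_functional M \<rho> \<longleftrightarrow>
     (\<forall>X\<in>L2 M. \<forall>Y\<in>L2 M. (AE \<omega> in M. X \<omega> = Y \<omega>) \<longrightarrow> \<rho> X = \<rho> Y)"

definition L2_separable :: "'a measure \<Rightarrow> bool" where
  "L2_separable M \<longleftrightarrow>
     (\<exists>D\<subseteq>(L2 M :: ('a \<Rightarrow> real) set). countable D \<and>
       (\<forall>X\<in>L2 M. \<forall>\<epsilon>>0. \<exists>Y\<in>D. L2_norm M (\<lambda>\<omega>. X \<omega> - Y \<omega>) < \<epsilon>))"

definition is_atom :: "'a measure \<Rightarrow> 'a set \<Rightarrow> bool" where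
  "is_atom M A \<longleftrightarrow> A \<in> sets M \<and> emeasure M A > 0 \<and>
     (\<forall>B\<in>sets M. B \<subseteq> A \<longrightarrow> emeasure M B = 0 \<or> emeasure M (A - B) = 0)"

definition same_distr ::
    "'a measure \<Rightarrow> ('a \<Rightarrow> 'b::euclidean_space) \<Rightarrow> ('a \<Rightarrow> 'b) \<Rightarrow> bool" where
  "same_distr M X Y \<longleftrightarrow> distr M borel X = distr M borel Y"

definition P2 :: "'b::euclidean_space measure set" where
  "P2 = {\<mu>. prob_space \<mu> \<and> sets \<mu> = sets borel \<and> integrable \<mu> (\<lambda>x. (norm x)\<^sup>2)}"

definition L2_convex ::
    "'a measure \<Rightarrow> (('a \<Rightarrow> 'b::euclidean_space) \<Rightarrow> real) \<Rightarrow> bool" where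
  "L2_convex M \<rho> \<longleftrightarrow>
     (\<forall>X\<in>L2 M. \<forall>Y\<in>L2 M. \<forall>t. 0 \<le> t \<and> t \<le> 1 \<longrightarrow>
        \<rho> (\<lambda>\<omega>. (1 - t) *\<^sub>R X \<omega> + t *\<^sub>R Y \<omega>) \<le> (1 - t) * \<rho> X + t * \<rho> Y)"

definition L2_continuous ::
    "'a measure \<Rightarrow> (('a \<Rightarrow> 'b::euclidean_space) \<Rightarrow> real) \<Rightarrow> bool" where
  "L2_continuous M \<rho> \<longleftrightarrow>
     (\<forall>X\<in>L2 M. \<forall>\<epsilon>>0. \<exists>\<delta>>0. \<forall>Y\<in>L2 M.
        L2_norm M (\<lambda>\<omega>. Y \<omega> - X \<omega>) < \<delta> \<longrightarrow> \<bar>\<rho> Y - \<rho> X\<bar> < \<epsilon>)"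

text \<open>
  Suprema are taken in the extended reals, because the supremum of an unbounded set of reals
  is an unspecified value; an equation with a real number thus asserts finiteness.
\<close>

definition structure_neutral ::
    "'a measure \<Rightarrow> (('a \<Rightarrow> 'b::euclidean_space) \<Rightarrow> real) \<Rightarrow> bool" where
  "structure_neutral M \<rho> \<longleftrightarrow>
     (\<forall>X\<in>L2 M. \<forall>Y\<in>L2 M.
        ereal (\<rho> X + \<rho> Y) =
        Sup {ereal (\<rho> (\<lambda>\<omega>. X' \<omega> + Y' \<omega>)) | X' Y'.
               X' \<in> L2 M \<and> Y' \<in> L2 M \<and> same_distr M X' X \<and> same_distr M Y' Y})"

definition strongly_coherent ::
    "'a measure \<Rightarrow> (('a \<Rightarrow> 'b::euclidean_space) \<Rightarrow> real) \<Rightarrow> bool" where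
  "strongly_coherent M \<rho> \<longleftrightarrow>
     L2_convex M \<rho> \<and> L2_continuous M \<rho> \<and> structure_neutral M \<rho>"

definition max_correlation ::
    "'a measure \<Rightarrow> 'b::euclidean_space measure \<Rightarrow> ('a \<Rightarrow> 'b) \<Rightarrow> ereal" where
  "max_correlation M \<mu> X =
     Sup {ereal (\<integral>\<omega>. X \<omega> \<bullet> U \<omega> \<partial>M) | U. U \<in> L2 M \<and> distr M borel U = \<mu>}"

end

theory Submission
  imports Defs
begin

text \<open>
  Since the space has no atoms, one member of a pair of random vectors can be replaced by any
  other one with the same law while the joint law is kept up to a small error. This makes
  \<open>\<rho>\<^sub>\<mu>\<close> law invariant and structure neutral.

  Conversely, neutrality makes \<open>\<rho>\<close> law invariant and sublinear. If \<open>\<rho>\<close> attains its maximum \<open>K\<close> over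
  the unit ball of \<open>L\<^sup>2\<close> at \<open>U\<close>, then comparing \<open>\<rho> (U + s X')\<close> with \<open>K * \<parallel>U + s X'\<parallel>\<close> to first
  order in \<open>s\<close>, for \<open>X' \<sim> X\<close>, shows that \<open>\<rho> X\<close> is the supremum of \<open>E[K U \<bullet> X']\<close>, so the law of
  \<open>K U\<close> is a baseline. The maximum is attained because neutrality, by the parallelogram law, lets a
  maximising sequence be replaced by a Cauchy sequence with the same laws.
\<close>

section \<open>Atomless probability spaces\<close>

text \<open>An exact replacement is out of reach: \<open>X'\<close> may generate the whole
  sigma-algebra, and then every measurable \<open>V'\<close> is a function of \<open>X'\<close>,
  whereas \<open>V\<close> need not be a function of \<open>X\<close>. A rounded \<open>X'\<close>
  takes only countably many values, its non-null level sets are still atomless, and inside each of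
  them any conditional law of \<open>V\<close> can be reproduced. Couplings are therefore exact for
  rounded vectors; the rounding error is absorbed by the Cauchy-Schwarz inequality for inner
  products and by the Lipschitz bound for \<open>\<rho>\<close>. Weak compactness of the unit ball
  would not give a maximiser: a convex continuous \<open>\<rho>\<close> is weakly lower
  semicontinuous, while a maximum asks for the opposite semicontinuity. This is why a
  norm-convergent sequence is needed.\<close>

locale atomless_prob_space = prob_space M for M :: "'a measure" +
  assumes no_atom: "\<nexists>A. is_atom M A"
begin

section \<open>Sets of prescribed probability\<close>

text \<open>A non-null set that is no atom splits into two non-null pieces, and the lighter piece
  has at most half of the mass.\<close>

lemma exists_half:
  assumes A: "A \<in> sets M" "0 < prob A"
  shows "\<exists>B\<in>sets M. B \<subseteq> A \<and> 0 < prob B \<and> prob B \<le> prob A / 2"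
proof -
  have "\<not> is_atom M A" using no_atom by blast
  then obtain B where B: "B \<in> sets M" "B \<subseteq> A" "emeasure M B \<noteq> 0" "emeasure M (A - B) \<noteq> 0"
    using A unfolding is_atom_def emeasure_eq_measure by auto
  have pos: "0 < prob B" "0 < prob (A - B)"
    using B(3,4) unfolding emeasure_eq_measure by (auto simp: zero_less_measure_iff)
  have sum: "prob (A - B) = prob A - prob B"
    using A B by (intro finite_measure_Diff) auto
  show ?thesis
  proof (cases "prob B \<le> prob A / 2")
    case True
    with B pos show ?thesis by blast
  next
    case False
    then show ?thesis using A B pos sum by (intro bexI[of _ "A - B"]) auto
  qed
qed

lemma exists_small:
  assumes A: "A \<in> sets M" "0 < prob A" and e: "0 < e"
  shows "\<exists>B\<in>sets M. B \<subseteq> A \<and> 0 < prob B \<and> prob B \<le> e"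
proof -
  have "\<exists>B\<in>sets M. B \<subseteq> A \<and> 0 < prob B \<and> prob B \<le> prob A / 2 ^ n" for n
  proof (induction n)
    case 0
    then show ?case using A by auto
  next
    case (Suc n)
    then obtain B where B: "B \<in> sets M" "B \<subseteq> A" "0 < prob B" "prob B \<le> prob A / 2 ^ n"
      by blast
    obtain C where "C \<in> sets M" "C \<subseteq> B" "0 < prob C" "prob C \<le> prob B / 2"
      using exists_half[OF B(1,3)] by blast
    moreover have "prob A / 2 ^ n / 2 = prob A / 2 ^ Suc n" by simp
    ultimately show ?case using B by (intro bexI[of _ C]) auto
  qed
  moreover have "(\<lambda>n. prob A / 2 ^ n) \<longlonglongrightarrow> 0"
    by real_asymp
  then have "\<forall>\<^sub>F n in sequentially. prob A / 2 ^ n < e"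
    using e by (rule order_tendstoD)
  then obtain n where "prob A / 2 ^ n < e"
    by (auto simp: eventually_sequentially)
  ultimately show ?thesis
    by (meson less_imp_le order_trans)
qed

text \<open>Sierpinski's theorem; each step adds at least half of the mass that can still be added.\<close>

lemma exists_subset_prob:
  assumes A: "A \<in> sets M" and t: "0 \<le> t" "t \<le> prob A"
  shows "\<exists>B\<in>sets M. B \<subseteq> A \<and> prob B = t"
proof -
  define P where "P B \<longleftrightarrow> B \<in> sets M \<and> B \<subseteq> A \<and> prob B \<le> t" for B
  \<comment> \<open>The supremum of the admissible masses need not be attained, so a step only has
    to gain half of what any admissible superset could gain.\<close>
  define Q where "Q B B' \<longleftrightarrow> B \<subseteq> B' \<and>
    (\<forall>C. P C \<longrightarrow> B \<subseteq> C \<longrightarrow> prob C - prob B \<le> 2 * (prob B' - prob B))" for B B'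
  have "\<exists>B. \<forall>n::nat. P (B n) \<and> Q (B n) (B (Suc n))"
  proof (rule dependent_nat_choice)
    show "\<exists>B. P B" using t by (intro exI[of _ "{}"]) (auto simp: P_def)
  next
    fix B assume B: "P B"
    define S where "S = prob ` {C. P C \<and> B \<subseteq> C}"
    have bdd: "bdd_above S" unfolding S_def by (rule bdd_aboveI2[of _ _ t]) (auto simp: P_def)
    have ne: "S \<noteq> {}" using B unfolding S_def by auto
    have le: "prob C \<le> Sup S" if "P C" "B \<subseteq> C" for C
      using that by (intro cSup_upper bdd) (auto simp: S_def)
    show "\<exists>B'. P B' \<and> Q B B'"
    proof (cases "Sup S = prob B")
      case True
      then show ?thesis using B le by (intro exI[of _ B]) (auto simp: Q_def)
    next
      case False
      then have "prob B < Sup S" using le[OF B] by auto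
      then have "(prob B + Sup S) / 2 < Sup S" by simp
      then have "\<exists>x\<in>S. (prob B + Sup S) / 2 < x" unfolding less_cSup_iff[OF ne bdd] .
      then obtain B' where "P B'" "B \<subseteq> B'" "(prob B + Sup S) / 2 < prob B'"
        unfolding S_def by blast
      then show ?thesis using le by (intro exI[of _ B']) (fastforce simp: Q_def)
    qed
  qed
  then obtain B where B: "\<And>n::nat. P (B n)" "\<And>n. Q (B n) (B (Suc n))" by blast
  have inc: "incseq B" using B(2) by (intro incseq_SucI) (auto simp: Q_def)
  have Bs: "B n \<in> sets M" for n using B(1) by (auto simp: P_def)
  define L where "L = (\<Union>n. B n)"
  have L: "L \<in> sets M" "L \<subseteq> A" using B(1) by (auto simp: L_def P_def)
  have lim: "(\<lambda>n. prob (B n)) \<longlonglongrightarrow> prob L"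
    unfolding L_def using inc Bs by (intro finite_Lim_measure_incseq) auto
  then have Lt: "prob L \<le> t"
    by (rule LIMSEQ_le_const2) (use B(1) in \<open>auto simp: P_def\<close>)
  have "prob L = t"
  proof (rule ccontr)
    assume "prob L \<noteq> t"
    then have lt: "prob L < t" using Lt by simp
    then have "0 < prob (A - L)" using L A t by (subst finite_measure_Diff) auto
    then obtain D where D: "D \<in> sets M" "D \<subseteq> A - L" "0 < prob D" "prob D \<le> t - prob L"
      using exists_small[of "A - L" "t - prob L"] A L lt by auto
    \<comment> \<open>\<open>D\<close> is disjoint from every \<open>B n\<close> and could have been
      added at every stage. So each increment is at least half of \<open>prob D\<close>, although
      the increments tend to 0.\<close>
    have "prob D \<le> 2 * (prob (B (Suc n)) - prob (B n))" for n
    proof -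
      have "prob (B n \<union> D) = prob (B n) + prob D"
        using D Bs by (intro finite_measure_Union) (auto simp: L_def)
      moreover have "prob (B n) \<le> prob L"
        using L by (intro finite_measure_mono) (auto simp: L_def)
      ultimately have "P (B n \<union> D)" using D B(1)[of n] L by (auto simp: P_def)
      then show ?thesis using B(2)[of n] \<open>prob (B n \<union> D) = _\<close> by (fastforce simp: Q_def)
    qed
    moreover have "(\<lambda>n. 2 * (prob (B (Suc n)) - prob (B n))) \<longlonglongrightarrow> 2 * (prob L - prob L)"
      using lim by (intro tendsto_intros LIMSEQ_Suc)
    ultimately have "prob D \<le> 2 * (prob L - prob L)" by (intro LIMSEQ_le_const) auto
    then show False using D by simp
  qed
  then show ?thesis using L by blast
qed

section \<open>Copying the joint law of a label and a sequence of events\<close>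

text \<open>The cell \<open>g = l\<close> is as heavy as the cell \<open>h = l\<close>, so it has a
  subset with the mass of the part of \<open>E\<close> in the latter. There are only countably many
  cells, so the union of these subsets is measurable.\<close>

lemma extend_label:
  fixes g h :: "'a \<Rightarrow> 'c::countable"
  assumes g[measurable]: "g \<in> M \<rightarrow>\<^sub>M count_space UNIV" and h[measurable]: "h \<in> M \<rightarrow>\<^sub>M count_space UNIV"
    and eq: "\<And>l. prob {\<omega>\<in>space M. g \<omega> = l} = prob {\<omega>\<in>space M. h \<omega> = l}"
    and E[measurable]: "E \<in> sets M"
  shows "\<exists>F\<in>sets M. \<forall>l b. prob {\<omega>\<in>space M. g \<omega> = l \<and> (\<omega> \<in> F) = b} =
    prob {\<omega>\<in>space M. h \<omega> = l \<and> (\<omega> \<in> E) = b}"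
proof -
  have "\<exists>D\<in>sets M. D \<subseteq> {\<omega>\<in>space M. g \<omega> = l} \<and> prob D = prob {\<omega>\<in>space M. h \<omega> = l \<and> \<omega> \<in> E}" for l
    by (rule exists_subset_prob) (auto simp: eq intro!: finite_measure_mono)
  then obtain D where D[measurable]: "\<And>l. D l \<in> sets M" and D': "\<And>l. D l \<subseteq> {\<omega>\<in>space M. g \<omega> = l}"
    "\<And>l. prob (D l) = prob {\<omega>\<in>space M. h \<omega> = l \<and> \<omega> \<in> E}" by metis
  define F where "F = (\<Union>l. D l)"
  have F[measurable]: "F \<in> sets M" unfolding F_def by (rule sets.countable_UN') auto
  have 1: "{\<omega>\<in>space M. g \<omega> = l \<and> \<omega> \<in> F} = D l" for l using D'(1) by (fastforce simp: F_def)
  have split: "prob {\<omega>\<in>space M. k \<omega> = l \<and> \<omega> \<notin> G} =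
      prob {\<omega>\<in>space M. k \<omega> = l} - prob {\<omega>\<in>space M. k \<omega> = l \<and> \<omega> \<in> G}"
    if [measurable]: "k \<in> M \<rightarrow>\<^sub>M count_space UNIV" "G \<in> sets M" for k :: "'a \<Rightarrow> 'c" and G l
    by (subst finite_measure_Diff[symmetric]) (auto intro!: arg_cong[where f=prob])
  show ?thesis
  proof (intro bexI[OF _ F] allI)
    fix l b
    show "prob {\<omega>\<in>space M. g \<omega> = l \<and> (\<omega> \<in> F) = b} = prob {\<omega>\<in>space M. h \<omega> = l \<and> (\<omega> \<in> E) = b}"
      by (cases b) (simp_all add: 1 D'(2) split eq)
  qed
qed

text \<open>Events are copied one at a time: the label together with the bits of the events copied
  so far is again a countable label, to which \<open>extend_label\<close> applies.\<close>

lemma extend_labels: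
  fixes g h :: "'a \<Rightarrow> 'c::countable"
  assumes g[measurable]: "g \<in> M \<rightarrow>\<^sub>M count_space UNIV" and h[measurable]: "h \<in> M \<rightarrow>\<^sub>M count_space UNIV"
    and eq: "\<And>l. prob {\<omega>\<in>space M. g \<omega> = l} = prob {\<omega>\<in>space M. h \<omega> = l}"
    and E[measurable]: "\<And>n::nat. E n \<in> sets M"
  shows "\<exists>F::nat \<Rightarrow> 'a set. (\<forall>n. F n \<in> sets M) \<and> (\<forall>n l b.
    prob {\<omega>\<in>space M. g \<omega> = l \<and> (\<forall>i<n. (\<omega> \<in> F i) = b i)} =
    prob {\<omega>\<in>space M. h \<omega> = l \<and> (\<forall>i<n. (\<omega> \<in> E i) = b i)})"
proof -
  \<comment> \<open>The bits are stored in a list because lists of booleans form a countable type,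
    unlike functions from \<open>nat\<close> to \<open>bool\<close>. Labels whose list does not have
    length \<open>n\<close> never occur.\<close>
  define lab where "lab k n G \<omega> = (k \<omega>, map (\<lambda>i. \<omega> \<in> G i) [0..<n])"
    for k :: "'a \<Rightarrow> 'c" and n and G :: "nat \<Rightarrow> 'a set" and \<omega>
  have lab_eq: "lab k n G \<omega> = (l, map b [0..<n]) \<longleftrightarrow> k \<omega> = l \<and> (\<forall>i<n. (\<omega> \<in> G i) = b i)" for k n G \<omega> l b
    by (auto simp: lab_def)
  have lab_m: "lab k n G \<in> M \<rightarrow>\<^sub>M count_space UNIV"
    if [measurable]: "k \<in> M \<rightarrow>\<^sub>M count_space UNIV" "\<And>i. G i \<in> sets M" for k n G
  proof (subst measurable_count_space_eq2_countable, intro conjI ballI)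
    fix p :: "'c \<times> bool list"
    show "lab k n G -` {p} \<inter> space M \<in> sets M"
    proof (cases "length (snd p) = n")
      case True
      then have "p = (fst p, map ((!) (snd p)) [0..<n])" using map_nth[of "snd p"] by (simp add: prod_eq_iff)
      then have "lab k n G -` {p} \<inter> space M =
          {\<omega>\<in>space M. k \<omega> = fst p \<and> (\<forall>i<n. (\<omega> \<in> G i) = (snd p ! i))}"
        using lab_eq[of k n G _ "fst p" "(!) (snd p)"] by auto
      then show ?thesis by simp
    next
      case False
      then have "lab k n G -` {p} = {}" by (auto simp: lab_def)
      then show ?thesis by simp
    qed
  qed auto
  define P where "P n G \<longleftrightarrow> (\<forall>i. G i \<in> sets M) \<and> (\<forall>l b.
    prob {\<omega>\<in>space M. g \<omega> = l \<and> (\<forall>i<n. (\<omega> \<in> G i) = b i)} =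
    prob {\<omega>\<in>space M. h \<omega> = l \<and> (\<forall>i<n. (\<omega> \<in> E i) = b i)})" for n and G :: "nat \<Rightarrow> 'a set"
  have "\<exists>G. \<forall>n. P n (G n) \<and> (\<forall>i<n. G (Suc n) i = G n i)"
  proof (rule dependent_nat_choice)
    show "\<exists>G. P 0 G" using eq by (intro exI[of _ "\<lambda>_. {}"]) (auto simp: P_def)
  next
    fix G n assume G: "P n G"
    have G_m[measurable]: "\<And>i. G i \<in> sets M" using G by (auto simp: P_def)
    have lab_law: "prob {\<omega>\<in>space M. lab g n G \<omega> = p} = prob {\<omega>\<in>space M. lab h n E \<omega> = p}" for p
    proof (cases "length (snd p) = n")
      case True
      then have "p = (fst p, map ((!) (snd p)) [0..<n])" using map_nth[of "snd p"] by (simp add: prod_eq_iff)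
      then show ?thesis
        using G lab_eq[of g n G _ "fst p" "(!) (snd p)"] lab_eq[of h n E _ "fst p" "(!) (snd p)"]
        by (simp add: P_def)
    next
      case False
      then have "\<And>\<omega>. lab g n G \<omega> \<noteq> p" "\<And>\<omega>. lab h n E \<omega> \<noteq> p" by (auto simp: lab_def)
      then show ?thesis by simp
    qed
    obtain F where F: "F \<in> sets M" and Feq: "\<And>p b.
      prob {\<omega>\<in>space M. lab g n G \<omega> = p \<and> (\<omega> \<in> F) = b} =
      prob {\<omega>\<in>space M. lab h n E \<omega> = p \<and> (\<omega> \<in> E n) = b}"
      using extend_label[OF lab_m[OF g G_m, of n] lab_m[OF h E, of n] lab_law E[of n]] by metis
    have "P (Suc n) (G(n := F))"
      unfolding P_def
    proof (intro conjI allI)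
      fix l b
      show "prob {\<omega>\<in>space M. g \<omega> = l \<and> (\<forall>i<Suc n. (\<omega> \<in> (G(n := F)) i) = b i)} =
        prob {\<omega>\<in>space M. h \<omega> = l \<and> (\<forall>i<Suc n. (\<omega> \<in> E i) = b i)}"
        using Feq[of "(l, map b [0..<n])" "b n"] unfolding lab_eq
        by (simp add: All_less_Suc conj_ac cong: conj_cong)
    qed (use F in auto)
    then show "\<exists>G'. P (Suc n) G' \<and> (\<forall>i<n. G' i = G i)"
      by (intro exI[of _ "G(n := F)"]) auto
  qed
  then obtain G where G: "\<And>n. P n (G n)" "\<And>n i. i < n \<Longrightarrow> G (Suc n) i = G n i" by blast
  \<comment> \<open>Stage \<open>n\<close> only changes the set with index \<open>n\<close>, so set
    number \<open>i\<close> is final from stage \<open>Suc i\<close> on and the diagonal below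
    collects the final sets.\<close>
  have stable: "G n i = G (Suc i) i" if "i < n" for n i
    using that
  proof (induction n)
    case (Suc n)
    then show ?case using G(2)[of i n] by (cases "i = n") auto
  qed simp
  show ?thesis
  proof (intro exI[of _ "\<lambda>i. G (Suc i) i"] conjI allI)
    show "G (Suc n) n \<in> sets M" for n using G(1) by (auto simp: P_def)
    show "prob {\<omega>\<in>space M. g \<omega> = l \<and> (\<forall>i<n. (\<omega> \<in> G (Suc i) i) = b i)} =
      prob {\<omega>\<in>space M. h \<omega> = l \<and> (\<forall>i<n. (\<omega> \<in> E i) = b i)}" for n l b
      using G(1)[of n] stable[of _ n] by (auto simp: P_def cong: conj_cong)
  qed
qed

text \<open>The half-spaces \<open>{x. q < x \<bullet> b}\<close> with rational \<open>q\<close> and basis vectors \<open>b\<close> determine a point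
  measurably, so it suffices to copy the joint law of countably many events.\<close>

lemma exists_coupled:
  fixes g h :: "'a \<Rightarrow> nat" and V :: "'a \<Rightarrow> 'b::euclidean_space"
  assumes g[measurable]: "g \<in> M \<rightarrow>\<^sub>M count_space UNIV" and h[measurable]: "h \<in> M \<rightarrow>\<^sub>M count_space UNIV"
    and eq: "\<And>l. prob {\<omega>\<in>space M. g \<omega> = l} = prob {\<omega>\<in>space M. h \<omega> = l}"
    and V[measurable]: "V \<in> borel_measurable M"
  shows "\<exists>V'\<in>borel_measurable M. distr M (count_space UNIV \<Otimes>\<^sub>M borel) (\<lambda>\<omega>. (g \<omega>, V' \<omega>)) =
    distr M (count_space UNIV \<Otimes>\<^sub>M borel) (\<lambda>\<omega>. (h \<omega>, V \<omega>))"
proof -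
  define D where "D = from_nat_into ((Basis :: 'b set) \<times> (\<rat> :: real set))"
  have D: "range D = Basis \<times> (\<rat> :: real set)"
    unfolding D_def
    by (intro range_from_nat_into countable_SIGMA countable_finite[OF finite_Basis] countable_rat)
      (auto intro: Rats_0)
  define E where "E n = {\<omega>\<in>space M. snd (D n) < V \<omega> \<bullet> fst (D n)}" for n
  have E[measurable]: "E n \<in> sets M" for n unfolding E_def by measurable
  obtain F where F[measurable]: "\<And>n::nat. F n \<in> sets M" and Feq: "\<And>n l b.
    prob {\<omega>\<in>space M. g \<omega> = l \<and> (\<forall>i<n. (\<omega> \<in> F i) = b i)} =
    prob {\<omega>\<in>space M. h \<omega> = l \<and> (\<forall>i<n. (\<omega> \<in> E i) = b i)}"
    using extend_labels[OF g h eq, of E, OF E] by blast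
  \<comment> \<open>Label and events become one point of a countable product: coordinate 0 is the
    label, coordinate \<open>Suc i\<close> the bit of event \<open>i\<close>.\<close>
  define code where "code k G \<omega> = case_nat (k \<omega>) (\<lambda>i. if \<omega> \<in> G i then 1 else 0)"
    for k :: "'a \<Rightarrow> nat" and G :: "nat \<Rightarrow> 'a set" and \<omega>
  let ?S = "\<Pi>\<^sub>M i\<in>(UNIV::nat set). count_space (UNIV :: nat set)"
  have code_m[measurable]: "code k G \<in> M \<rightarrow>\<^sub>M ?S"
    if [measurable]: "k \<in> M \<rightarrow>\<^sub>M count_space UNIV" "\<And>i. G i \<in> sets M" for k G
  proof (rule measurable_PiM_single')
    show "(\<lambda>\<omega>. code k G \<omega> i) \<in> M \<rightarrow>\<^sub>M count_space UNIV" for i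
      by (cases i) (auto simp: code_def)
  qed auto
  have code_eq: "(\<forall>i<Suc n. code k G \<omega> i = s i) \<longleftrightarrow>
      k \<omega> = s 0 \<and> (\<forall>i<n. (if \<omega> \<in> G i then 1 else 0) = s (Suc i))" for k n G \<omega> s
    unfolding All_less_Suc2 by (simp add: code_def)
  have cyl: "prob {\<omega>\<in>space M. \<forall>i<n. code g F \<omega> i = s i} = prob {\<omega>\<in>space M. \<forall>i<n. code h E \<omega> i = s i}" for n s
  proof (cases n)
    case (Suc m)
    show ?thesis
    proof (cases "\<forall>i<m. s (Suc i) \<le> 1")
      case True
      then have "(\<forall>i<n. code k G \<omega> i = s i) \<longleftrightarrow> k \<omega> = s 0 \<and> (\<forall>i<m. (\<omega> \<in> G i) = (s (Suc i) = 1))" for k G \<omega>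
        unfolding Suc code_eq by (force simp: le_Suc_eq)
      then show ?thesis using Feq by simp
    next
      case False
      then have "(\<forall>i<n. code k G \<omega> i = s i) = False" for k G \<omega>
        unfolding Suc code_eq by (metis order_refl zero_le_one)
      then show ?thesis by (simp only:)
    qed
  qed simp
  have law: "distr M ?S (code g F) = distr M ?S (code h E)"
  proof (rule measure_eqI_PiM_infinite[where M="\<lambda>_. count_space UNIV" and I=UNIV])
    fix A :: "nat \<Rightarrow> nat set" and J :: "nat set" assume J: "finite J"
    obtain n where n: "J \<subseteq> {..<n}" using finite_nat_bounded[OF J] by blast
    let ?X = "prod_emb UNIV (\<lambda>_. count_space UNIV) J (Pi\<^sub>E J A)"
    define T where "T = {xs :: nat list. length xs = n \<and> (\<forall>i\<in>J. xs ! i \<in> A i)}"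
    have emb: "x \<in> ?X \<longleftrightarrow> map x [0..<n] \<in> T" for x
      using n by (fastforce simp: prod_emb_def T_def PiE_iff restrict_def extensional_def)
    \<comment> \<open>Finitely many coordinates are packed into a list, so that the law lives on a
      countable type and is determined by its values on singletons.\<close>
    let ?L = "\<lambda>k G \<omega>. map (code k G \<omega>) [0..<n]"
    have vimage: "?L k G -` {xs} \<inter> space M =
        (if length xs = n then {\<omega>\<in>space M. \<forall>i<n. code k G \<omega> i = xs ! i} else {})" for k G xs
    proof -
      have "?L k G \<omega> = xs \<longleftrightarrow> length xs = n \<and> (\<forall>i<n. code k G \<omega> i = xs ! i)" for \<omega>
        unfolding list_eq_iff_nth_eq by auto
      then show ?thesis by (cases "length xs = n") (simp_all add: vimage_def Int_def conj_commute)
    qed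
    have L_m: "?L k G \<in> M \<rightarrow>\<^sub>M count_space UNIV"
      if [measurable]: "k \<in> M \<rightarrow>\<^sub>M count_space UNIV" "\<And>i. G i \<in> sets M" for k G
    proof (subst measurable_count_space_eq2_countable, intro conjI ballI)
      have [measurable]: "(\<lambda>\<omega>. code k G \<omega> i) \<in> M \<rightarrow>\<^sub>M count_space UNIV" for i
        by (rule measurable_compose[OF code_m[OF that]]) (rule measurable_component_singleton, simp)
      show "?L k G -` {xs} \<inter> space M \<in> sets M" for xs
        unfolding vimage by simp
    qed auto
    have "distr M (count_space UNIV) (?L g F) = distr M (count_space UNIV) (?L h E)"
    proof (rule measure_eqI_countable[where A=UNIV])
      show "emeasure (distr M (count_space UNIV) (?L g F)) {xs} =
          emeasure (distr M (count_space UNIV) (?L h E)) {xs}" for xs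
        by (subst (1 2) emeasure_distr) (simp_all add: L_m g h F E vimage emeasure_eq_measure cyl)
    qed (auto intro: countableI_type finite_measure.emeasure_finite[OF finite_measure_distr] L_m g h F E)
    then have "emeasure M (?L g F -` T \<inter> space M) = emeasure M (?L h E -` T \<inter> space M)"
      by (metis emeasure_distr L_m g h F E sets_count_space UNIV_I Pow_UNIV)
    moreover have "code k G -` ?X \<inter> space M = ?L k G -` T \<inter> space M" for k G
      using emb by auto
    ultimately show "emeasure (distr M ?S (code g F)) ?X = emeasure (distr M ?S (code h E)) ?X"
      using J by (simp add: emeasure_distr g h F E code_m sets_PiM_I)
  qed (auto intro!: finite_measure.finite_measure_distr finite_measure_axioms)
  \<comment> \<open>Decoding: a coordinate is the supremum of the rationals below it, and minus
    infinity makes an index irrelevant. For \<open>code g F\<close> the supremum may be infinite at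
    some points; \<open>real_of_ereal\<close> supplies a default there, which does not disturb the
    comparison of laws.\<close>
  define \<phi> where "\<phi> s = (\<Sum>b\<in>Basis. real_of_ereal (SUP n. if fst (D n) = b \<and> s (Suc n) = 1
    then ereal (snd (D n)) else -\<infinity>) *\<^sub>R b)" for s :: "nat \<Rightarrow> nat"
  have \<phi>[measurable]: "\<phi> \<in> ?S \<rightarrow>\<^sub>M borel" unfolding \<phi>_def by measurable
  have V_eq: "\<phi> (code h E \<omega>) = V \<omega>" if \<omega>: "\<omega> \<in> space M" for \<omega>
  proof -
    have "(SUP n. if fst (D n) = b \<and> code h E \<omega> (Suc n) = 1 then ereal (snd (D n)) else -\<infinity>) = ereal (V \<omega> \<bullet> b)"
      if b: "b \<in> Basis" for b
    proof (rule SUP_eqI)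
      show "(if fst (D n) = b \<and> code h E \<omega> (Suc n) = 1 then ereal (snd (D n)) else -\<infinity>) \<le> ereal (V \<omega> \<bullet> b)" for n
        by (auto simp: code_def E_def)
    next
      fix y assume y: "\<And>n. n \<in> UNIV \<Longrightarrow>
        (if fst (D n) = b \<and> code h E \<omega> (Suc n) = 1 then ereal (snd (D n)) else -\<infinity>) \<le> y"
      have *: "ereal q \<le> y" if q: "q \<in> \<rat>" "q < V \<omega> \<bullet> b" for q
      proof -
        have "(b, q) \<in> range D" using D b q by auto
        then obtain n where "D n = (b, q)" by (metis imageE)
        then show ?thesis using y[of n] q \<omega> by (simp add: code_def E_def)
      qed
      show "ereal (V \<omega> \<bullet> b) \<le> y"
      proof (rule ccontr)
        assume "\<not> ereal (V \<omega> \<bullet> b) \<le> y"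
        then have "y < ereal (V \<omega> \<bullet> b)" by simp
        then obtain z where z: "y < ereal z" "z < V \<omega> \<bullet> b" using ereal_dense2 by fastforce
        obtain q where "q \<in> \<rat>" "z < q" "q < V \<omega> \<bullet> b" using Rats_dense_in_real[OF z(2)] by blast
        with *[of q] z show False by (metis ereal_less_eq(3) leD less_imp_le order_trans)
      qed
    qed
    then show ?thesis unfolding \<phi>_def by (simp add: euclidean_representation)
  qed
  \<comment> \<open>Both pairs are images of their codes under one fixed measurable map, so equal
    laws of the codes give equal laws of the pairs.\<close>
  have push: "distr M (count_space UNIV \<Otimes>\<^sub>M borel) (\<lambda>\<omega>. (k \<omega>, \<phi> (code k G \<omega>))) =
      distr (distr M ?S (code k G)) (count_space UNIV \<Otimes>\<^sub>M borel) (\<lambda>s. (s 0, \<phi> s))"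
    if [measurable]: "k \<in> M \<rightarrow>\<^sub>M count_space UNIV" "\<And>i. G i \<in> sets M" for k G
    by (subst distr_distr) (auto simp: comp_def code_def)
  have "distr M (count_space UNIV \<Otimes>\<^sub>M borel) (\<lambda>\<omega>. (g \<omega>, \<phi> (code g F \<omega>))) =
      distr M (count_space UNIV \<Otimes>\<^sub>M borel) (\<lambda>\<omega>. (h \<omega>, \<phi> (code h E \<omega>)))"
    by (simp add: push law)
  also have "\<dots> = distr M (count_space UNIV \<Otimes>\<^sub>M borel) (\<lambda>\<omega>. (h \<omega>, V \<omega>))"
    by (intro distr_cong) (auto simp: V_eq)
  finally show ?thesis by (intro bexI[of _ "\<lambda>\<omega>. \<phi> (code g F \<omega>)"]) auto
qed

end

section \<open>Square-integrable random vectors\<close>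

definition L2_inner :: "'a measure \<Rightarrow> ('a \<Rightarrow> 'b::euclidean_space) \<Rightarrow> ('a \<Rightarrow> 'b) \<Rightarrow> real" where
  "L2_inner M X Y = (\<integral>\<omega>. X \<omega> \<bullet> Y \<omega> \<partial>M)"

lemma L2_measurable: "X \<in> L2 M \<Longrightarrow> X \<in> borel_measurable M"
  by (simp add: L2_def)

lemma L2_scaleR: "X \<in> L2 M \<Longrightarrow> (\<lambda>\<omega>. c *\<^sub>R X \<omega>) \<in> L2 M"
  by (auto simp: L2_def power_mult_distrib)

lemma L2_add:
  assumes X: "X \<in> L2 M" and Y: "Y \<in> L2 M"
  shows "(\<lambda>\<omega>. X \<omega> + Y \<omega>) \<in> L2 M"
proof -
  have [measurable]: "X \<in> borel_measurable M" "Y \<in> borel_measurable M"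
    using X Y by (auto simp: L2_def)
  \<comment> \<open>The right-hand side exceeds the left-hand side by
    \<open>(norm (x - y))\<^sup>2\<close>.\<close>
  have ineq: "(norm (x + y))\<^sup>2 \<le> 2 * (norm x)\<^sup>2 + 2 * (norm y)\<^sup>2" for x y :: 'b
    using zero_le_power2[of "norm (x - y)"] by (simp add: power2_norm_eq_inner inner_simps inner_commute)
  have "integrable M (\<lambda>\<omega>. (norm (X \<omega> + Y \<omega>))\<^sup>2)"
  proof (rule Bochner_Integration.integrable_bound)
    show "integrable M (\<lambda>\<omega>. 2 * (norm (X \<omega>))\<^sup>2 + 2 * (norm (Y \<omega>))\<^sup>2)"
      using X Y by (simp add: L2_def)
    show "AE \<omega> in M. norm ((norm (X \<omega> + Y \<omega>))\<^sup>2) \<le> norm (2 * (norm (X \<omega>))\<^sup>2 + 2 * (norm (Y \<omega>))\<^sup>2)"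
      using ineq[THEN order_trans[OF _ abs_ge_self]] by (intro AE_I2) simp
  qed measurable
  then show ?thesis by (simp add: L2_def)
qed

lemma L2_diff:
  assumes "X \<in> L2 M" "Y \<in> L2 M"
  shows "(\<lambda>\<omega>. X \<omega> - Y \<omega>) \<in> L2 M"
  using L2_add[OF assms(1) L2_scaleR[OF assms(2), of "-1"]] by simp

lemma L2_inner_integrable:
  assumes X: "X \<in> L2 M" and Y: "Y \<in> L2 M"
  shows "integrable M (\<lambda>\<omega>. X \<omega> \<bullet> Y \<omega>)"
proof -
  have [measurable]: "X \<in> borel_measurable M" "Y \<in> borel_measurable M"
    using X Y by (auto simp: L2_def)
  have ineq: "\<bar>x \<bullet> y\<bar> \<le> (norm x)\<^sup>2 + (norm y)\<^sup>2" for x y :: 'b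
  proof -
    have "\<bar>x \<bullet> y\<bar> \<le> norm x * norm y" by (rule Cauchy_Schwarz_ineq2)
    also have "\<dots> \<le> (norm x)\<^sup>2 + (norm y)\<^sup>2"
      using zero_le_power2[of "norm x - norm y"] zero_le_power2[of "norm x"] zero_le_power2[of "norm y"]
      unfolding power2_diff by linarith
    finally show ?thesis .
  qed
  show ?thesis
  proof (rule Bochner_Integration.integrable_bound)
    show "integrable M (\<lambda>\<omega>. (norm (X \<omega>))\<^sup>2 + (norm (Y \<omega>))\<^sup>2)"
      using X Y by (simp add: L2_def)
    show "AE \<omega> in M. norm (X \<omega> \<bullet> Y \<omega>) \<le> norm ((norm (X \<omega>))\<^sup>2 + (norm (Y \<omega>))\<^sup>2)"
      using ineq[THEN order_trans[OF _ abs_ge_self]] by (intro AE_I2) (simp only: real_norm_def)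
  qed measurable
qed

lemma L2_inner_commute: "L2_inner M X Y = L2_inner M Y X"
  by (simp add: L2_inner_def inner_commute)

lemma L2_inner_add_right:
  assumes "X \<in> L2 M" "Y \<in> L2 M" "Z \<in> L2 M"
  shows "L2_inner M X (\<lambda>\<omega>. Y \<omega> + Z \<omega>) = L2_inner M X Y + L2_inner M X Z"
  using assms by (simp add: L2_inner_def inner_add_right L2_inner_integrable)

lemma L2_inner_diff_right:
  assumes "X \<in> L2 M" "Y \<in> L2 M" "Z \<in> L2 M"
  shows "L2_inner M X (\<lambda>\<omega>. Y \<omega> - Z \<omega>) = L2_inner M X Y - L2_inner M X Z"
  using assms by (simp add: L2_inner_def inner_diff_right L2_inner_integrable)

lemma L2_inner_scaleR_right: "L2_inner M X (\<lambda>\<omega>. c *\<^sub>R Y \<omega>) = c * L2_inner M X Y"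
  by (simp add: L2_inner_def)


lemma L2_inner_scaleR_left: "L2_inner M (\<lambda>\<omega>. c *\<^sub>R X \<omega>) Y = c * L2_inner M X Y"
  by (simp add: L2_inner_def)

lemma L2_norm_nonneg [simp]: "0 \<le> L2_norm M X"
  by (simp add: L2_norm_def)

lemma L2_norm_power2: "(L2_norm M X)\<^sup>2 = L2_inner M X X"
  by (simp add: L2_norm_def L2_inner_def power2_norm_eq_inner)

lemma L2_norm_scaleR: "L2_norm M (\<lambda>\<omega>. c *\<^sub>R X \<omega>) = \<bar>c\<bar> * L2_norm M X"
  by (simp add: L2_norm_def power_mult_distrib real_sqrt_mult)

lemma L2_norm_minus_commute: "L2_norm M (\<lambda>\<omega>. X \<omega> - Y \<omega>) = L2_norm M (\<lambda>\<omega>. Y \<omega> - X \<omega>)"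
  by (simp add: L2_norm_def norm_minus_commute)

lemma L2_norm_add_power2:
  assumes X: "X \<in> L2 M" and Y: "Y \<in> L2 M"
  shows "(L2_norm M (\<lambda>\<omega>. X \<omega> + Y \<omega>))\<^sup>2 = (L2_norm M X)\<^sup>2 + 2 * L2_inner M X Y + (L2_norm M Y)\<^sup>2"
proof -
  have "L2_inner M (\<lambda>\<omega>. X \<omega> + Y \<omega>) (\<lambda>\<omega>. X \<omega> + Y \<omega>) =
      L2_inner M (\<lambda>\<omega>. X \<omega> + Y \<omega>) X + L2_inner M (\<lambda>\<omega>. X \<omega> + Y \<omega>) Y"
    using assms by (intro L2_inner_add_right L2_add)
  also have "\<dots> = L2_inner M X (\<lambda>\<omega>. X \<omega> + Y \<omega>) + L2_inner M Y (\<lambda>\<omega>. X \<omega> + Y \<omega>)"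
    by (simp only: L2_inner_commute)
  also have "\<dots> = L2_inner M X X + L2_inner M X Y + (L2_inner M Y X + L2_inner M Y Y)"
    using assms by (simp only: L2_inner_add_right)
  finally show ?thesis by (simp add: L2_norm_power2 L2_inner_commute[of M Y X])
qed

lemma L2_norm_diff_power2:
  assumes X: "X \<in> L2 M" and Y: "Y \<in> L2 M"
  shows "(L2_norm M (\<lambda>\<omega>. X \<omega> - Y \<omega>))\<^sup>2 = (L2_norm M X)\<^sup>2 - 2 * L2_inner M X Y + (L2_norm M Y)\<^sup>2"
  using L2_norm_add_power2[OF X L2_scaleR[OF Y, of "-1"]]
    L2_norm_scaleR[of M "-1" Y] L2_inner_scaleR_right[of M X "-1" Y] by simp

text \<open>The usual expansion of the squared norm of a combination of \<open>X\<close> and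
  \<open>Y\<close> ends with a division by the product of the two norms. Both norms are enlarged by
  \<open>d > 0\<close> to cover null vectors, and \<open>d\<close> tends to 0.\<close>

lemma L2_Cauchy_Schwarz:
  assumes X: "X \<in> L2 M" and Y: "Y \<in> L2 M"
  shows "L2_inner M X Y \<le> L2_norm M X * L2_norm M Y"
proof (rule field_le_epsilon)
  define a b where "a = L2_norm M X" and "b = L2_norm M Y"
  have ab: "0 \<le> a" "0 \<le> b" by (simp_all add: a_def b_def)
  fix e :: real assume e: "0 < e"
  have bound: "L2_inner M X Y \<le> (a + d) * (b + d)" if d: "0 < d" for d
  proof -
    have "0 \<le> (L2_norm M (\<lambda>\<omega>. (b + d) *\<^sub>R X \<omega> - (a + d) *\<^sub>R Y \<omega>))\<^sup>2" by simp
    also have "\<dots> = ((b + d) * a)\<^sup>2 - 2 * ((a + d) * (b + d)) * L2_inner M X Y + ((a + d) * b)\<^sup>2"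
      using ab d L2_norm_diff_power2[OF L2_scaleR[OF X] L2_scaleR[OF Y], of "b + d" "a + d"]
      by (simp add: L2_norm_scaleR L2_inner_scaleR_right L2_inner_scaleR_left a_def b_def mult_ac)
    finally have "2 * ((a + d) * (b + d)) * L2_inner M X Y \<le> ((b + d) * a)\<^sup>2 + ((a + d) * b)\<^sup>2"
      by simp
    also have "\<dots> \<le> ((b + d) * (a + d))\<^sup>2 + ((a + d) * (b + d))\<^sup>2"
      using ab d by (intro add_mono power_mono mult_left_mono) auto
    also have "\<dots> = 2 * ((a + d) * (b + d)) * ((a + d) * (b + d))"
      by (simp add: power2_eq_square mult_ac)
    finally show ?thesis using ab d by (simp add: mult_le_cancel_left_pos)
  qed
  have "((\<lambda>d. (a + d) * (b + d)) \<longlongrightarrow> (a + 0) * (b + 0)) (at_right 0)"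
    by (intro tendsto_intros)
  then have "\<forall>\<^sub>F d in at_right 0. (a + d) * (b + d) < a * b + e"
    using e by (intro order_tendstoD) auto
  moreover have "\<forall>\<^sub>F d in at_right 0. (0::real) < d"
    by (simp add: eventually_at_right_less)
  ultimately have "\<forall>\<^sub>F d::real in at_right 0. L2_inner M X Y \<le> a * b + e"
    by eventually_elim (use bound in fastforce)
  then show "L2_inner M X Y \<le> L2_norm M X * L2_norm M Y + e"
    by (simp add: a_def b_def)
qed

lemma L2_norm_triangle:
  assumes X: "X \<in> L2 M" and Y: "Y \<in> L2 M"
  shows "L2_norm M (\<lambda>\<omega>. X \<omega> + Y \<omega>) \<le> L2_norm M X + L2_norm M Y"
proof (rule power2_le_imp_le)
  show "(L2_norm M (\<lambda>\<omega>. X \<omega> + Y \<omega>))\<^sup>2 \<le> (L2_norm M X + L2_norm M Y)\<^sup>2"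
    using L2_Cauchy_Schwarz[OF X Y] by (simp add: L2_norm_add_power2[OF X Y] power2_sum)
qed simp

lemma L2_norm_triangle_diff:
  assumes X: "X \<in> L2 M" and Y: "Y \<in> L2 M" and Z: "Z \<in> L2 M"
  shows "L2_norm M (\<lambda>\<omega>. X \<omega> - Z \<omega>) \<le> L2_norm M (\<lambda>\<omega>. X \<omega> - Y \<omega>) + L2_norm M (\<lambda>\<omega>. Y \<omega> - Z \<omega>)"
  using L2_norm_triangle[OF L2_diff[OF X Y] L2_diff[OF Y Z]] by simp

section \<open>Quantities that depend only on the law\<close>

lemma same_distr_integral:
  fixes X X' :: "'a \<Rightarrow> 'b::euclidean_space" and f :: "'b \<Rightarrow> real"
  assumes "same_distr M X' X" "X' \<in> borel_measurable M" "X \<in> borel_measurable M"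
    and "f \<in> borel_measurable borel"
  shows "(\<integral>\<omega>. f (X' \<omega>) \<partial>M) = (\<integral>\<omega>. f (X \<omega>) \<partial>M)"
  using assms integral_distr[of X' M borel f] integral_distr[of X M borel f]
  by (simp add: same_distr_def)

lemma same_distr_L2:
  assumes d: "same_distr M X' X" and X': "X' \<in> borel_measurable M" and X: "X \<in> L2 M"
  shows "X' \<in> L2 M"
proof -
  have "integrable (distr M borel X) (\<lambda>x. (norm x)\<^sup>2)"
    using X by (subst integrable_distr_eq) (auto simp: L2_def)
  then have "integrable (distr M borel X') (\<lambda>x. (norm x)\<^sup>2)"
    using d by (simp add: same_distr_def)
  then show ?thesis using X' by (subst (asm) integrable_distr_eq) (auto simp: L2_def)
qed

lemma same_distr_L2_norm:
  assumes "same_distr M X' X" "X' \<in> borel_measurable M" "X \<in> borel_measurable M"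
  shows "L2_norm M X' = L2_norm M X"
  using same_distr_integral[OF assms, of "\<lambda>x. (norm x)\<^sup>2"] by (simp add: L2_norm_def)

lemma same_distr_sym: "same_distr M X Y \<Longrightarrow> same_distr M Y X"
  by (simp add: same_distr_def)

lemma same_distr_trans: "same_distr M X Y \<Longrightarrow> same_distr M Y Z \<Longrightarrow> same_distr M X Z"
  by (simp add: same_distr_def)

lemma same_distr_compose:
  assumes "same_distr M X Y" "X \<in> borel_measurable M" "Y \<in> borel_measurable M" "f \<in> borel_measurable borel"
  shows "same_distr M (\<lambda>\<omega>. f (X \<omega>)) (\<lambda>\<omega>. f (Y \<omega>))"
  using assms distr_distr[of f borel borel X M] distr_distr[of f borel borel Y M]
  by (simp add: same_distr_def comp_def)

context prob_space begin

lemma L2_const: "(\<lambda>_. c) \<in> L2 M"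
  by (simp add: L2_def)

lemma L2_norm_le_const:
  assumes "X \<in> L2 M" "\<And>\<omega>. \<omega> \<in> space M \<Longrightarrow> norm (X \<omega>) \<le> d" "0 \<le> d"
  shows "L2_norm M X \<le> d"
proof -
  have "(\<integral>\<omega>. (norm (X \<omega>))\<^sup>2 \<partial>M) \<le> (\<integral>\<omega>. d\<^sup>2 \<partial>M)"
    using assms by (intro integral_mono) (auto simp: L2_def intro!: power_mono)
  then have "(\<integral>\<omega>. (norm (X \<omega>))\<^sup>2 \<partial>M) \<le> d\<^sup>2" by (simp add: prob_space)
  then show ?thesis unfolding L2_norm_def by (rule real_le_lsqrt[OF assms(3)])
qed

lemma L1_le_L2_norm:
  assumes X: "X \<in> L2 M"
  shows "integrable M (\<lambda>\<omega>. norm (X \<omega>))" "(\<integral>\<omega>. norm (X \<omega>) \<partial>M) \<le> L2_norm M X"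
proof -
  have N: "(\<lambda>\<omega>. norm (X \<omega>)) \<in> L2 M" using X by (auto simp: L2_def)
  have one: "(\<lambda>\<omega>. 1::real) \<in> L2 M" by (rule L2_const)
  show "integrable M (\<lambda>\<omega>. norm (X \<omega>))" using L2_inner_integrable[OF N one] by simp
  show "(\<integral>\<omega>. norm (X \<omega>) \<partial>M) \<le> L2_norm M X"
    using L2_Cauchy_Schwarz[OF N one] by (simp add: L2_inner_def L2_norm_def prob_space)
qed

text \<open>The Riesz-Fischer argument for a fast sequence: on a probability space the increments
  are also summable in the L1 norm, so almost every path converges, and Fatou's lemma carries the
  tail bounds to the limit. The factor 2 is the sum of the geometric series.\<close>

lemma L2_complete:
  fixes u :: "nat \<Rightarrow> 'a \<Rightarrow> 'b::euclidean_space"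
  assumes u: "\<And>n. u n \<in> L2 M" and cauchy: "\<And>n. L2_norm M (\<lambda>\<omega>. u (Suc n) \<omega> - u n \<omega>) \<le> (1 / 2) ^ n"
  shows "\<exists>U\<in>L2 M. \<forall>n. L2_norm M (\<lambda>\<omega>. u n \<omega> - U \<omega>) \<le> 2 * (1 / 2) ^ n"
proof -
  have um[measurable]: "u n \<in> borel_measurable M" for n using u by (rule L2_measurable)
  define d where "d n \<omega> = norm (u (Suc n) \<omega> - u n \<omega>)" for n \<omega>
  have dm[measurable]: "d n \<in> borel_measurable M" for n unfolding d_def by measurable
  have "(\<integral>\<^sup>+\<omega>. (\<Sum>n. ennreal (d n \<omega>)) \<partial>M) = (\<Sum>n. \<integral>\<^sup>+\<omega>. ennreal (d n \<omega>) \<partial>M)"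
    by (rule nn_integral_suminf) measurable
  also have "\<dots> \<le> (\<Sum>n. ennreal ((1 / 2) ^ n))"
  proof (intro suminf_le summableI)
    fix n
    have "(\<integral>\<^sup>+\<omega>. ennreal (d n \<omega>) \<partial>M) = ennreal (\<integral>\<omega>. d n \<omega> \<partial>M)"
      unfolding d_def by (intro nn_integral_eq_integral L1_le_L2_norm L2_diff u) auto
    also have "\<dots> \<le> ennreal ((1 / 2) ^ n)"
      unfolding d_def using L1_le_L2_norm(2)[OF L2_diff[OF u[of "Suc n"] u[of n]]] cauchy[of n]
      by (intro ennreal_leI) linarith
    finally show "(\<integral>\<^sup>+\<omega>. ennreal (d n \<omega>) \<partial>M) \<le> ennreal ((1 / 2) ^ n)" .
  qed
  also have "\<dots> = ennreal (\<Sum>n. (1 / 2) ^ n)"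
    by (intro suminf_ennreal2 summable_geometric) auto
  also have "\<dots> < \<infinity>" by simp
  finally have "AE \<omega> in M. (\<Sum>n. ennreal (d n \<omega>)) \<noteq> \<infinity>"
    by (intro nn_integral_PInf_AE) auto
  then have conv: "AE \<omega> in M. (\<lambda>n. u n \<omega>) \<longlonglongrightarrow> lim (\<lambda>n. u n \<omega>)"
  proof eventually_elim
    case (elim \<omega>)
    then have "summable (\<lambda>n. norm (u (Suc n) \<omega> - u n \<omega>))"
      unfolding d_def by (intro summable_suminf_not_top) (auto simp: top_ennreal_def)
    then have "summable (\<lambda>n. u (Suc n) \<omega> - u n \<omega>)" by (rule summable_norm_cancel)
    then have "convergent (\<lambda>n. \<Sum>i<n. u (Suc i) \<omega> - u i \<omega>)" by (simp add: summable_iff_convergent)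
    then have "convergent (\<lambda>n. (\<Sum>i<n. u (Suc i) \<omega> - u i \<omega>) + u 0 \<omega>)"
      by (intro convergent_add convergent_const)
    then have "convergent (\<lambda>n. u n \<omega>)" by (simp add: sum_lessThan_telescope[of "\<lambda>n. u n \<omega>"])
    then show ?case by (simp add: convergent_LIMSEQ_iff)
  qed
  \<comment> \<open>Where the sequence diverges, \<open>lim\<close> is an unspecified value; this
    concerns only a null set, and \<open>U\<close> is still measurable.\<close>
  define U where "U \<omega> = lim (\<lambda>n. u n \<omega>)" for \<omega>
  have Um[measurable]: "U \<in> borel_measurable M" unfolding U_def by measurable
  have tail: "L2_norm M (\<lambda>\<omega>. u n \<omega> - u (n + k) \<omega>) \<le> 2 * (1 / 2) ^ n - 2 * (1 / 2) ^ (n + k)" for n k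
  proof (induction k)
    case 0
    then show ?case by (simp add: L2_norm_def)
  next
    case (Suc k)
    have "L2_norm M (\<lambda>\<omega>. u n \<omega> - u (n + Suc k) \<omega>) \<le>
        L2_norm M (\<lambda>\<omega>. u n \<omega> - u (n + k) \<omega>) + L2_norm M (\<lambda>\<omega>. u (n + k) \<omega> - u (n + Suc k) \<omega>)"
      by (intro L2_norm_triangle_diff u)
    also have "\<dots> \<le> 2 * (1 / 2) ^ n - 2 * (1 / 2) ^ (n + k) + (1 / 2) ^ (n + k)"
      using Suc cauchy[of "n + k"] by (simp add: L2_norm_minus_commute[of M "u (n + k)"])
    finally show ?case by simp
  qed
  have fatou: "(\<integral>\<^sup>+\<omega>. ennreal ((norm (u n \<omega> - U \<omega>))\<^sup>2) \<partial>M) \<le> ennreal ((2 * (1 / 2) ^ n)\<^sup>2)" for n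
  proof -
    have "(\<integral>\<^sup>+\<omega>. ennreal ((norm (u n \<omega> - U \<omega>))\<^sup>2) \<partial>M) =
        (\<integral>\<^sup>+\<omega>. liminf (\<lambda>k. ennreal ((norm (u n \<omega> - u k \<omega>))\<^sup>2)) \<partial>M)"
    proof (rule nn_integral_cong_AE, use conv in eventually_elim)
      case (elim \<omega>)
      then have "(\<lambda>k. ennreal ((norm (u n \<omega> - u k \<omega>))\<^sup>2)) \<longlonglongrightarrow> ennreal ((norm (u n \<omega> - U \<omega>))\<^sup>2)"
        unfolding U_def by (intro tendsto_intros)
      from lim_imp_Liminf[OF sequentially_bot this] show ?case by (rule sym)
    qed
    also have "\<dots> \<le> liminf (\<lambda>k. \<integral>\<^sup>+\<omega>. ennreal ((norm (u n \<omega> - u k \<omega>))\<^sup>2) \<partial>M)"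
      by (rule nn_integral_liminf) measurable
    also have "\<dots> \<le> ennreal ((2 * (1 / 2) ^ n)\<^sup>2)"
    proof (rule Liminf_le, simp, rule eventually_sequentiallyI)
      fix k assume "n \<le> k"
      then have "L2_norm M (\<lambda>\<omega>. u n \<omega> - u k \<omega>) \<le> 2 * (1 / 2) ^ n"
        using tail[of n "k - n"] by (simp add: order_trans)
      then have "(L2_norm M (\<lambda>\<omega>. u n \<omega> - u k \<omega>))\<^sup>2 \<le> (2 * (1 / 2) ^ n)\<^sup>2"
        by (intro power_mono) auto
      then have "ennreal (\<integral>\<omega>. (norm (u n \<omega> - u k \<omega>))\<^sup>2 \<partial>M) \<le> ennreal ((2 * (1 / 2) ^ n)\<^sup>2)"
        by (intro ennreal_leI) (simp add: L2_norm_def)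
      then show "(\<integral>\<^sup>+\<omega>. ennreal ((norm (u n \<omega> - u k \<omega>))\<^sup>2) \<partial>M) \<le> ennreal ((2 * (1 / 2) ^ n)\<^sup>2)"
        using L2_diff[OF u[of n] u[of k]] by (subst nn_integral_eq_integral) (auto simp: L2_def)
    qed
    finally show ?thesis .
  qed
  have diff: "(\<lambda>\<omega>. u n \<omega> - U \<omega>) \<in> L2 M" for n
    unfolding L2_def using le_less_trans[OF fatou[of n]]
    by (auto intro!: integrableI_bounded simp: less_top)
  have "L2_norm M (\<lambda>\<omega>. u n \<omega> - U \<omega>) \<le> 2 * (1 / 2) ^ n" for n
  proof -
    have "ennreal (\<integral>\<omega>. (norm (u n \<omega> - U \<omega>))\<^sup>2 \<partial>M) \<le> ennreal ((2 * (1 / 2) ^ n)\<^sup>2)"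
      using fatou[of n] diff[of n] by (subst (asm) nn_integral_eq_integral) (auto simp: L2_def)
    then have "(L2_norm M (\<lambda>\<omega>. u n \<omega> - U \<omega>))\<^sup>2 \<le> (2 * (1 / 2) ^ n)\<^sup>2"
      by (subst (asm) ennreal_le_iff) (auto simp: L2_norm_def)
    then show ?thesis by (rule power2_le_imp_le) simp
  qed
  moreover have "U \<in> L2 M" using L2_diff[OF u[of 0] diff[of 0]] by simp
  ultimately show ?thesis by blast
qed

lemma L2_bounded:
  assumes [measurable]: "X \<in> borel_measurable M" and "\<And>\<omega>. \<omega> \<in> space M \<Longrightarrow> norm (X \<omega>) \<le> d"
  shows "X \<in> L2 M"
proof -
  have "(norm (X \<omega>))\<^sup>2 \<le> d\<^sup>2" if "\<omega> \<in> space M" for \<omega>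
    using assms(2)[OF that] by (intro power_mono) auto
  then have "integrable M (\<lambda>\<omega>. (norm (X \<omega>))\<^sup>2)"
    by (intro integrable_const_bound[where B="d\<^sup>2"]) auto
  then show ?thesis by (simp add: L2_def)
qed

end

section \<open>Rounding and approximate couplings\<close>

text \<open>The label of \<open>x\<close> is the least index of a point within
  \<open>\<delta>\<close> in a countable dense set. Countably many labels, rather than finitely
  many, make the error uniform even for unbounded vectors.\<close>

lemma exists_discretization:
  assumes "0 < \<delta>"
  shows "\<exists>(c :: 'b::euclidean_space \<Rightarrow> nat) r.
    c \<in> borel \<rightarrow>\<^sub>M count_space UNIV \<and> (\<forall>x. norm (r (c x) - x) \<le> \<delta>)"
proof -
  obtain D :: "'b set" where D: "countable D" "\<And>X. open X \<Longrightarrow> X \<noteq> {} \<Longrightarrow> \<exists>d\<in>D. d \<in> X"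
    using countable_dense_exists by blast
  define r where "r = from_nat_into D"
  have "D \<noteq> {}" using D(2)[of UNIV] by auto
  then have r: "range r = D" unfolding r_def using D(1) by (rule range_from_nat_into)
  define c where "c x = (LEAST n. dist x (r n) < \<delta>)" for x
  have "dist x (r (c x)) < \<delta>" for x
  proof -
    have "\<exists>d\<in>D. d \<in> ball x \<delta>" using assms by (intro D(2)) auto
    then have "\<exists>n. dist x (r n) < \<delta>" unfolding r[symmetric] by auto
    then show ?thesis unfolding c_def by (rule LeastI_ex)
  qed
  then have "norm (r (c x) - x) \<le> \<delta>" for x
    by (metis dist_commute dist_norm less_imp_le)
  moreover have "c \<in> borel \<rightarrow>\<^sub>M count_space UNIV" unfolding c_def by measurable
  ultimately show ?thesis by blast
qed

context atomless_prob_space begin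

text \<open>\<open>R\<close> and \<open>R'\<close> are the rounded versions of \<open>X\<close> and
  \<open>X'\<close>. Since \<open>V'\<close> is coupled to the cell label of \<open>X'\<close> as
  \<open>V\<close> is to that of \<open>X\<close>, the pairs agree exactly in law and the error sits
  in the first components alone.\<close>

lemma exists_approx_coupled:
  fixes X X' :: "'a \<Rightarrow> 'b::euclidean_space" and V :: "'a \<Rightarrow> 'c::euclidean_space"
  assumes X[measurable]: "X \<in> borel_measurable M" and X'[measurable]: "X' \<in> borel_measurable M"
    and eq: "same_distr M X' X" and V[measurable]: "V \<in> borel_measurable M" and \<delta>: "0 < \<delta>"
  shows "\<exists>V' R R'. V' \<in> borel_measurable M \<and> R \<in> borel_measurable M \<and> R' \<in> borel_measurable M \<and>
    same_distr M V' V \<and> (\<forall>\<omega>. norm (R \<omega> - X \<omega>) \<le> \<delta>) \<and> (\<forall>\<omega>. norm (R' \<omega> - X' \<omega>) \<le> \<delta>) \<and>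
    distr M (borel \<Otimes>\<^sub>M borel) (\<lambda>\<omega>. (R' \<omega>, V' \<omega>)) = distr M (borel \<Otimes>\<^sub>M borel) (\<lambda>\<omega>. (R \<omega>, V \<omega>))"
proof -
  obtain c :: "'b \<Rightarrow> nat" and r where c[measurable]: "c \<in> borel \<rightarrow>\<^sub>M count_space UNIV"
    and r: "\<And>x. norm (r (c x) - x) \<le> \<delta>"
    using exists_discretization[OF \<delta>] by blast
  have rm[measurable]: "r \<in> count_space UNIV \<rightarrow>\<^sub>M borel" by simp
  have law: "prob {\<omega>\<in>space M. c (Y \<omega>) = l} = measure (distr M borel Y) {x. c x = l}"
    if [measurable]: "Y \<in> borel_measurable M" for Y l
    by (subst measure_distr) (auto intro!: arg_cong[where f=prob])
  have "prob {\<omega>\<in>space M. c (X' \<omega>) = l} = prob {\<omega>\<in>space M. c (X \<omega>) = l}" for l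
    using eq by (simp add: law same_distr_def)
  then obtain V' where V'[measurable]: "V' \<in> borel_measurable M"
    and pair: "distr M (count_space UNIV \<Otimes>\<^sub>M borel) (\<lambda>\<omega>. (c (X' \<omega>), V' \<omega>)) =
      distr M (count_space UNIV \<Otimes>\<^sub>M borel) (\<lambda>\<omega>. (c (X \<omega>), V \<omega>))"
    using exists_coupled[of "\<lambda>\<omega>. c (X' \<omega>)" "\<lambda>\<omega>. c (X \<omega>)" V] by (auto intro: measurable_compose[OF _ c])
  have snd_law: "distr M borel W = distr (distr M (count_space UNIV \<Otimes>\<^sub>M borel) (\<lambda>\<omega>. (c (Y \<omega>), W \<omega>))) borel snd"
    if [measurable]: "Y \<in> borel_measurable M" "W \<in> borel_measurable M" for Y and W :: "'a \<Rightarrow> 'c"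
    by (subst distr_distr) (auto simp: comp_def)
  have "same_distr M V' V"
    unfolding same_distr_def snd_law[OF X V] snd_law[OF X' V'] pair ..
  moreover have "distr M (borel \<Otimes>\<^sub>M borel) (\<lambda>\<omega>. (r (c (Y \<omega>)), W \<omega>)) =
      distr (distr M (count_space UNIV \<Otimes>\<^sub>M borel) (\<lambda>\<omega>. (c (Y \<omega>), W \<omega>))) (borel \<Otimes>\<^sub>M borel) (\<lambda>(n, w). (r n, w))"
    if [measurable]: "Y \<in> borel_measurable M" "W \<in> borel_measurable M" for Y and W :: "'a \<Rightarrow> 'c"
    by (subst distr_distr) (auto simp: comp_def)
  then have "distr M (borel \<Otimes>\<^sub>M borel) (\<lambda>\<omega>. (r (c (X' \<omega>)), V' \<omega>)) =
      distr M (borel \<Otimes>\<^sub>M borel) (\<lambda>\<omega>. (r (c (X \<omega>)), V \<omega>))"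
    using pair by simp
  ultimately show ?thesis
    using r by (intro exI[of _ V'] exI[of _ "\<lambda>\<omega>. r (c (X \<omega>))"] exI[of _ "\<lambda>\<omega>. r (c (X' \<omega>))"] conjI) auto
qed

lemma exists_coupled_inner:
  fixes X X' V :: "'a \<Rightarrow> 'b::euclidean_space"
  assumes X: "X \<in> L2 M" and X': "X' \<in> L2 M" and eq: "same_distr M X' X" and V: "V \<in> L2 M"
    and e: "0 < e"
  shows "\<exists>V'\<in>L2 M. same_distr M V' V \<and> L2_inner M X V - e \<le> L2_inner M X' V'"
proof -
  \<comment> \<open>Rounding \<open>X\<close> and rounding \<open>X'\<close> each change the inner
    product by at most \<open>\<delta> * L2_norm M V\<close>, hence by at most \<open>e / 2\<close>;
    the added 1 keeps the divisor positive.\<close>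
  define \<delta> where "\<delta> = e / 2 / (L2_norm M V + 1)"
  have pos: "0 < L2_norm M V + 1" using L2_norm_nonneg[of M V] by linarith
  then have \<delta>: "0 < \<delta>" using e by (simp add: \<delta>_def)
  note [measurable] = X[THEN L2_measurable] X'[THEN L2_measurable] V[THEN L2_measurable]
  obtain V' R R' where m[measurable]: "V' \<in> borel_measurable M" "R \<in> borel_measurable M" "R' \<in> borel_measurable M"
    and V'V: "same_distr M V' V" and R: "\<And>\<omega>. norm (R \<omega> - X \<omega>) \<le> \<delta>" "\<And>\<omega>. norm (R' \<omega> - X' \<omega>) \<le> \<delta>"
    and pair: "distr M (borel \<Otimes>\<^sub>M borel) (\<lambda>\<omega>. (R' \<omega>, V' \<omega>)) = distr M (borel \<Otimes>\<^sub>M borel) (\<lambda>\<omega>. (R \<omega>, V \<omega>))"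
    using exists_approx_coupled[OF X[THEN L2_measurable] X'[THEN L2_measurable] eq V[THEN L2_measurable] \<delta>]
    by blast
  have V': "V' \<in> L2 M" using same_distr_L2[OF V'V _ V] by simp
  have bd: "(\<lambda>\<omega>. R \<omega> - X \<omega>) \<in> L2 M" "(\<lambda>\<omega>. R' \<omega> - X' \<omega>) \<in> L2 M"
    using R by (auto intro!: L2_bounded)
  have "R \<in> L2 M" "R' \<in> L2 M" using L2_add[OF bd(1) X] L2_add[OF bd(2) X'] by simp_all
  have inner: "L2_inner M Y W = (\<integral>(x, v). x \<bullet> v \<partial>distr M (borel \<Otimes>\<^sub>M borel) (\<lambda>\<omega>. (Y \<omega>, W \<omega>)))"
    if [measurable]: "Y \<in> borel_measurable M" "W \<in> borel_measurable M" for Y W :: "'a \<Rightarrow> 'b"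
    unfolding L2_inner_def by (subst integral_distr) auto
  have RV: "L2_inner M R' V' = L2_inner M R V"
    using pair by (simp add: inner)
  have err: "\<bar>L2_inner M S W - L2_inner M Y W\<bar> \<le> \<delta> * L2_norm M W"
    if S: "S \<in> L2 M" and Y: "Y \<in> L2 M" and W: "W \<in> L2 M" and le: "\<And>\<omega>. norm (S \<omega> - Y \<omega>) \<le> \<delta>"
    for S Y W :: "'a \<Rightarrow> 'b"
  proof -
    have *: "L2_inner M W A - L2_inner M W B \<le> \<delta> * L2_norm M W"
      if A: "A \<in> L2 M" and B: "B \<in> L2 M" and AB: "\<And>\<omega>. norm (A \<omega> - B \<omega>) \<le> \<delta>" for A B
    proof -
      have "L2_inner M W A - L2_inner M W B = L2_inner M W (\<lambda>\<omega>. A \<omega> - B \<omega>)"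
        using W A B by (simp add: L2_inner_diff_right)
      also have "\<dots> \<le> L2_norm M W * L2_norm M (\<lambda>\<omega>. A \<omega> - B \<omega>)"
        by (intro L2_Cauchy_Schwarz W L2_diff A B)
      also have "\<dots> \<le> L2_norm M W * \<delta>"
        using L2_diff[OF A B] AB \<delta> by (intro mult_left_mono L2_norm_le_const) auto
      finally show ?thesis by (simp add: mult.commute)
    qed
    show ?thesis
      using *[OF S Y le] *[OF Y S] le by (simp add: L2_inner_commute[of M W] norm_minus_commute)
  qed
  have "\<delta> * L2_norm M V \<le> \<delta> * (L2_norm M V + 1)" using \<delta> by simp
  also have "\<dots> = e / 2"
    using pos unfolding \<delta>_def by (metis less_irrefl nonzero_divide_eq_eq)
  finally have "\<delta> * L2_norm M V \<le> e / 2" .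
  moreover have "L2_norm M V' = L2_norm M V" using same_distr_L2_norm[OF V'V] by simp
  ultimately have "L2_inner M X V - e \<le> L2_inner M X' V'"
    using err[OF \<open>R \<in> L2 M\<close> X V R(1)] err[OF \<open>R' \<in> L2 M\<close> X' V' R(2)] RV by simp
  with V' V'V show ?thesis by blast
qed

text \<open>This serves a functional that is known only to be law invariant and Lipschitz: its
  values at \<open>X + V\<close> and at \<open>X' + V'\<close> are compared through \<open>Z\<close>
  and \<open>Z'\<close>, which are the sums of the rounded pairs.\<close>

lemma exists_coupled_sum:
  fixes X X' V :: "'a \<Rightarrow> 'b::euclidean_space"
  assumes X: "X \<in> L2 M" and X': "X' \<in> L2 M" and eq: "same_distr M X' X" and V: "V \<in> L2 M"
    and \<delta>: "0 < \<delta>"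
  shows "\<exists>V'\<in>L2 M. \<exists>Z\<in>L2 M. \<exists>Z'\<in>L2 M. same_distr M V' V \<and> same_distr M Z' Z \<and>
    L2_norm M (\<lambda>\<omega>. Z \<omega> - (X \<omega> + V \<omega>)) \<le> \<delta> \<and> L2_norm M (\<lambda>\<omega>. Z' \<omega> - (X' \<omega> + V' \<omega>)) \<le> \<delta>"
proof -
  note [measurable] = X[THEN L2_measurable] X'[THEN L2_measurable] V[THEN L2_measurable]
  obtain V' R R' where m[measurable]: "V' \<in> borel_measurable M" "R \<in> borel_measurable M" "R' \<in> borel_measurable M"
    and V'V: "same_distr M V' V" and R: "\<And>\<omega>. norm (R \<omega> - X \<omega>) \<le> \<delta>" "\<And>\<omega>. norm (R' \<omega> - X' \<omega>) \<le> \<delta>"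
    and pair: "distr M (borel \<Otimes>\<^sub>M borel) (\<lambda>\<omega>. (R' \<omega>, V' \<omega>)) = distr M (borel \<Otimes>\<^sub>M borel) (\<lambda>\<omega>. (R \<omega>, V \<omega>))"
    using exists_approx_coupled[OF X[THEN L2_measurable] X'[THEN L2_measurable] eq V[THEN L2_measurable] \<delta>]
    by blast
  have V': "V' \<in> L2 M" using same_distr_L2[OF V'V _ V] by simp
  have bd: "(\<lambda>\<omega>. R \<omega> - X \<omega>) \<in> L2 M" "(\<lambda>\<omega>. R' \<omega> - X' \<omega>) \<in> L2 M"
    using R by (auto intro!: L2_bounded)
  have RL: "R \<in> L2 M" "R' \<in> L2 M" using L2_add[OF bd(1) X] L2_add[OF bd(2) X'] by simp_all
  have sum: "distr M borel (\<lambda>\<omega>. Y \<omega> + W \<omega>) =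
      distr (distr M (borel \<Otimes>\<^sub>M borel) (\<lambda>\<omega>. (Y \<omega>, W \<omega>))) borel (\<lambda>(x, v). x + v)"
    if [measurable]: "Y \<in> borel_measurable M" "W \<in> borel_measurable M" for Y W :: "'a \<Rightarrow> 'b"
    by (subst distr_distr) (auto simp: comp_def)
  show ?thesis
  proof (intro bexI conjI)
    show "same_distr M (\<lambda>\<omega>. R' \<omega> + V' \<omega>) (\<lambda>\<omega>. R \<omega> + V \<omega>)"
      using pair by (simp add: same_distr_def sum)
    show "L2_norm M (\<lambda>\<omega>. R \<omega> + V \<omega> - (X \<omega> + V \<omega>)) \<le> \<delta>"
      using bd(1) R(1) \<delta> by (simp add: L2_norm_le_const)
    show "L2_norm M (\<lambda>\<omega>. R' \<omega> + V' \<omega> - (X' \<omega> + V' \<omega>)) \<le> \<delta>"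
      using bd(2) R(2) \<delta> by (simp add: L2_norm_le_const)
  qed (use V' V'V RL V in \<open>auto intro: L2_add\<close>)
qed

end

section \<open>Maximal correlation is strongly coherent\<close>

context atomless_prob_space begin

text \<open>The admissible \<open>U\<close> act as linear functionals of one common norm, whence
  convexity and a Lipschitz bound. For neutrality, a \<open>U\<close> that is nearly optimal for
  \<open>X\<close> becomes nearly optimal for a suitable copy of \<open>Y\<close> too.\<close>

lemma max_correlation_strongly_coherent:
  fixes \<rho> :: "('a \<Rightarrow> 'b::euclidean_space) \<Rightarrow> real"
  assumes \<rho>: "\<And>X. X \<in> L2 M \<Longrightarrow> ereal (\<rho> X) = max_correlation M \<mu> X"
  shows "strongly_coherent M \<rho>"
proof -
  have ge: "L2_inner M X U \<le> \<rho> X" if "X \<in> L2 M" "U \<in> L2 M" "distr M borel U = \<mu>" for X U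
  proof -
    have "ereal (L2_inner M X U) \<le> max_correlation M \<mu> X"
      unfolding max_correlation_def L2_inner_def using that by (intro Sup_upper) auto
    then show ?thesis using \<rho>[OF that(1)] by (metis ereal_less_eq(3))
  qed
  have approx: "\<exists>U\<in>L2 M. distr M borel U = \<mu> \<and> \<rho> X - e < L2_inner M X U" if X: "X \<in> L2 M" and e: "0 < e" for X e
  proof -
    have "ereal (\<rho> X - e) < max_correlation M \<mu> X" using \<rho>[OF X, symmetric] e by simp
    then show ?thesis unfolding max_correlation_def less_Sup_iff L2_inner_def by auto
  qed
  \<comment> \<open>An empty supremum would be minus infinity, so the real value of
    \<open>\<rho>\<close> at 0 forces some vector to have law \<open>\<mu>\<close>.\<close>
  obtain U0 where U0: "U0 \<in> L2 M" "distr M borel U0 = \<mu>"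
    using approx[OF L2_const[of 0], of 1] by auto
  have norm_eq: "L2_norm M U = L2_norm M U0" if "U \<in> L2 M" "distr M borel U = \<mu>" for U
    using that U0 by (intro same_distr_L2_norm) (auto simp: same_distr_def L2_measurable)
  have law: "\<rho> X \<le> \<rho> X'" if X: "X \<in> L2 M" "X' \<in> L2 M" "same_distr M X' X" for X X'
  proof (rule field_le_epsilon)
    fix e :: real assume e: "0 < e"
    then obtain U where U: "U \<in> L2 M" "distr M borel U = \<mu>" "\<rho> X - e / 2 < L2_inner M X U"
      using approx[OF X(1), of "e / 2"] by auto
    obtain U' where U': "U' \<in> L2 M" "same_distr M U' U" "L2_inner M X U - e / 2 \<le> L2_inner M X' U'"
      using exists_coupled_inner[OF X U(1), of "e / 2"] e by auto
    show "\<rho> X \<le> \<rho> X' + e"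
      using ge[OF X(2) U'(1)] U U' by (simp add: same_distr_def)
  qed
  have sub: "\<rho> (\<lambda>\<omega>. X \<omega> + Y \<omega>) \<le> \<rho> X + \<rho> Y" if X: "X \<in> L2 M" and Y: "Y \<in> L2 M" for X Y
  proof (rule field_le_epsilon)
    fix e :: real assume "0 < e"
    then obtain U where U: "U \<in> L2 M" "distr M borel U = \<mu>"
      "\<rho> (\<lambda>\<omega>. X \<omega> + Y \<omega>) - e < L2_inner M (\<lambda>\<omega>. X \<omega> + Y \<omega>) U"
      using approx[OF L2_add[OF X Y]] by blast
    then show "\<rho> (\<lambda>\<omega>. X \<omega> + Y \<omega>) \<le> \<rho> X + \<rho> Y + e"
      using ge[OF X U(1,2)] ge[OF Y U(1,2)] L2_inner_add_right[OF U(1) X Y]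
      by (simp add: L2_inner_commute[of M _ U])
  qed
  have bound: "\<rho> X \<le> L2_norm M U0 * L2_norm M X" if X: "X \<in> L2 M" for X
  proof (rule field_le_epsilon)
    fix e :: real assume "0 < e"
    then obtain U where U: "U \<in> L2 M" "distr M borel U = \<mu>" "\<rho> X - e < L2_inner M X U"
      using approx[OF X] by blast
    then show "\<rho> X \<le> L2_norm M U0 * L2_norm M X + e"
      using L2_Cauchy_Schwarz[OF X U(1)] norm_eq[OF U(1,2)] by (simp add: mult.commute)
  qed
  have lip: "\<rho> Y \<le> \<rho> X + L2_norm M U0 * L2_norm M (\<lambda>\<omega>. Y \<omega> - X \<omega>)"
    if X: "X \<in> L2 M" and Y: "Y \<in> L2 M" for X Y
    using sub[OF X L2_diff[OF Y X]] bound[OF L2_diff[OF Y X]] by simp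
  have "L2_convex M \<rho>"
    unfolding L2_convex_def
  proof (intro ballI allI impI, elim conjE)
    fix X Y :: "'a \<Rightarrow> 'b" and t :: real
    assume X: "X \<in> L2 M" and Y: "Y \<in> L2 M" and t: "0 \<le> t" "t \<le> 1"
    let ?Z = "\<lambda>\<omega>. (1 - t) *\<^sub>R X \<omega> + t *\<^sub>R Y \<omega>"
    have Z: "?Z \<in> L2 M" by (intro L2_add L2_scaleR X Y)
    show "\<rho> ?Z \<le> (1 - t) * \<rho> X + t * \<rho> Y"
    proof (rule field_le_epsilon)
      fix e :: real assume "0 < e"
      then obtain U where U: "U \<in> L2 M" "distr M borel U = \<mu>" "\<rho> ?Z - e < L2_inner M ?Z U"
        using approx[OF Z] by blast
      have "L2_inner M ?Z U = (1 - t) * L2_inner M X U + t * L2_inner M Y U"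
        using L2_inner_add_right[OF U(1) L2_scaleR[OF X] L2_scaleR[OF Y], of "1 - t" t]
        by (simp add: L2_inner_commute[of M _ U] L2_inner_scaleR_right)
      also have "\<dots> \<le> (1 - t) * \<rho> X + t * \<rho> Y"
        using ge[OF X U(1,2)] ge[OF Y U(1,2)] t by (intro add_mono mult_left_mono) auto
      finally show "\<rho> ?Z \<le> (1 - t) * \<rho> X + t * \<rho> Y + e" using U(3) by simp
    qed
  qed
  moreover have "L2_continuous M \<rho>"
    unfolding L2_continuous_def
  proof (intro ballI allI impI)
    fix X :: "'a \<Rightarrow> 'b" and e :: real assume X: "X \<in> L2 M" and e: "0 < e"
    define K where "K = L2_norm M U0 + 1"
    have K: "0 < K" unfolding K_def using L2_norm_nonneg[of M U0] by linarith
    show "\<exists>\<delta>>0. \<forall>Y\<in>L2 M. L2_norm M (\<lambda>\<omega>. Y \<omega> - X \<omega>) < \<delta> \<longrightarrow> \<bar>\<rho> Y - \<rho> X\<bar> < e"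
    proof (intro exI conjI ballI impI)
      show "0 < e / K" using e K by simp
      fix Y :: "'a \<Rightarrow> 'b" assume Y: "Y \<in> L2 M" and less: "L2_norm M (\<lambda>\<omega>. Y \<omega> - X \<omega>) < e / K"
      have "\<bar>\<rho> Y - \<rho> X\<bar> \<le> L2_norm M U0 * L2_norm M (\<lambda>\<omega>. Y \<omega> - X \<omega>)"
        using lip[OF X Y] lip[OF Y X] by (simp add: L2_norm_minus_commute[of M X Y] abs_le_iff)
      also have "\<dots> \<le> K * L2_norm M (\<lambda>\<omega>. Y \<omega> - X \<omega>)"
        by (intro mult_right_mono) (auto simp: K_def)
      also have "\<dots> < e" using less K by (simp add: pos_less_divide_eq mult.commute)
      finally show "\<bar>\<rho> Y - \<rho> X\<bar> < e" .
    qed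
  qed
  moreover have "structure_neutral M \<rho>"
    unfolding structure_neutral_def
  proof (intro ballI antisym)
    fix X Y :: "'a \<Rightarrow> 'b" assume X: "X \<in> L2 M" and Y: "Y \<in> L2 M"
    let ?S = "{ereal (\<rho> (\<lambda>\<omega>. X' \<omega> + Y' \<omega>)) | X' Y'.
               X' \<in> L2 M \<and> Y' \<in> L2 M \<and> same_distr M X' X \<and> same_distr M Y' Y}"
    show "Sup ?S \<le> ereal (\<rho> X + \<rho> Y)"
    proof (rule Sup_least, elim CollectE exE conjE)
      fix z X' Y' assume z: "z = ereal (\<rho> (\<lambda>\<omega>. X' \<omega> + Y' \<omega>))"
        and *: "X' \<in> L2 M" "Y' \<in> L2 M" "same_distr M X' X" "same_distr M Y' Y"
      have "\<rho> X' \<le> \<rho> X" "\<rho> Y' \<le> \<rho> Y"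
        using * X Y by (auto intro!: law same_distr_sym)
      then show "z \<le> ereal (\<rho> X + \<rho> Y)" using sub[OF *(1,2)] by (simp add: z)
    qed
    show "ereal (\<rho> X + \<rho> Y) \<le> Sup ?S"
    proof (rule ereal_le_epsilon2)
      fix e :: real assume e: "0 < e"
      obtain U where U: "U \<in> L2 M" "distr M borel U = \<mu>" "\<rho> X - e / 3 < L2_inner M X U"
        using approx[OF X, of "e / 3"] e by auto
      obtain V where V: "V \<in> L2 M" "distr M borel V = \<mu>" "\<rho> Y - e / 3 < L2_inner M Y V"
        using approx[OF Y, of "e / 3"] e by auto
      \<comment> \<open>The coupling goes from \<open>V\<close> to \<open>U\<close>:
        \<open>Y'\<close> is correlated with \<open>U\<close> almost as \<open>Y\<close> is with
        \<open>V\<close>, while \<open>X\<close> and \<open>U\<close> stay fixed. The three errors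
        \<open>e / 3\<close> come from \<open>U\<close>, from \<open>V\<close> and from this
        coupling.\<close>
      have "same_distr M U V" using U V by (simp add: same_distr_def)
      then obtain Y' where Y': "Y' \<in> L2 M" "same_distr M Y' Y" "L2_inner M V Y - e / 3 \<le> L2_inner M U Y'"
        using exists_coupled_inner[OF V(1) U(1) _ Y, of "e / 3"] e by auto
      have "\<rho> X + \<rho> Y \<le> L2_inner M (\<lambda>\<omega>. X \<omega> + Y' \<omega>) U + e"
        using U(3) V(3) Y'(3) L2_inner_add_right[OF U(1) X Y'(1)]
        by (simp add: L2_inner_commute[of M _ U] L2_inner_commute[of M Y V])
      also have "\<dots> \<le> \<rho> (\<lambda>\<omega>. X \<omega> + Y' \<omega>) + e"
        using ge[OF L2_add[OF X Y'(1)] U(1,2)] by simp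
      finally have "ereal (\<rho> X + \<rho> Y) \<le> ereal (\<rho> (\<lambda>\<omega>. X \<omega> + Y' \<omega>)) + ereal e" by simp
      also have "\<dots> \<le> Sup ?S + ereal e"
        using X Y' by (intro add_right_mono Sup_upper) (auto simp: same_distr_def)
      finally show "ereal (\<rho> X + \<rho> Y) \<le> Sup ?S + ereal e" .
    qed
  qed
  ultimately show ?thesis by (simp add: strongly_coherent_def)
qed

end

section \<open>Strongly coherent risk measures are maximal correlations\<close>

locale strongly_coherent_risk = atomless_prob_space M for M :: "'a measure" +
  fixes \<rho> :: "('a \<Rightarrow> 'b::euclidean_space) \<Rightarrow> real"
  assumes functional: "L2_functional M \<rho>" and coherent: "strongly_coherent M \<rho>"
begin

section \<open>Law invariance and sublinearity from neutrality\<close>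

lemma convex:
  "X \<in> L2 M \<Longrightarrow> Y \<in> L2 M \<Longrightarrow> 0 \<le> t \<Longrightarrow> t \<le> 1 \<Longrightarrow>
    \<rho> (\<lambda>\<omega>. (1 - t) *\<^sub>R X \<omega> + t *\<^sub>R Y \<omega>) \<le> (1 - t) * \<rho> X + t * \<rho> Y"
  using coherent by (simp add: strongly_coherent_def L2_convex_def)

lemma neutral:
  assumes "X \<in> L2 M" "Y \<in> L2 M"
  shows "ereal (\<rho> X + \<rho> Y) = Sup {ereal (\<rho> (\<lambda>\<omega>. X' \<omega> + Y' \<omega>)) | X' Y'.
    X' \<in> L2 M \<and> Y' \<in> L2 M \<and> same_distr M X' X \<and> same_distr M Y' Y}"
  using coherent assms by (simp add: strongly_coherent_def structure_neutral_def)

lemma subadditive: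
  assumes X: "X \<in> L2 M" and Y: "Y \<in> L2 M"
  shows "\<rho> (\<lambda>\<omega>. X \<omega> + Y \<omega>) \<le> \<rho> X + \<rho> Y"
proof -
  have "ereal (\<rho> (\<lambda>\<omega>. X \<omega> + Y \<omega>)) \<le> ereal (\<rho> X + \<rho> Y)"
    unfolding neutral[OF X Y] using X Y by (intro Sup_upper) (auto simp: same_distr_def)
  then show ?thesis by simp
qed

text \<open>Every copy of 0 vanishes almost everywhere, so neutrality for the pair 0, 0 reads
  \<open>2 * \<rho> 0 = \<rho> 0\<close>. Here the invariance of \<open>\<rho>\<close> under
  almost-everywhere equality enters.\<close>

lemma zero: "\<rho> (\<lambda>_. 0) = 0"
proof -
  have null: "AE \<omega> in M. X \<omega> = 0" if X: "X \<in> L2 M" "same_distr M X (\<lambda>_. 0)" for X :: "'a \<Rightarrow> 'b"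
  proof -
    have [measurable]: "X \<in> borel_measurable M" by (rule L2_measurable[OF X(1)])
    have "AE x in distr M borel (\<lambda>_. 0 :: 'b). x = 0" by (subst AE_distr_iff) auto
    then have "AE x in distr M borel X. x = 0" using X(2) by (simp only: same_distr_def)
    then show ?thesis by (subst (asm) AE_distr_iff) auto
  qed
  have "\<rho> (\<lambda>\<omega>. X \<omega> + Y \<omega>) = \<rho> (\<lambda>_. 0)"
    if "X \<in> L2 M" "Y \<in> L2 M" "same_distr M X (\<lambda>_. 0)" "same_distr M Y (\<lambda>_. 0)" for X Y
  proof -
    have "AE \<omega> in M. X \<omega> + Y \<omega> = 0"
      using null[OF that(1,3)] null[OF that(2,4)] by eventually_elim simp
    then show ?thesis
      by (rule functional[unfolded L2_functional_def, rule_format, OF L2_add[OF that(1,2)] L2_const])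
  qed
  then have "Sup {ereal (\<rho> (\<lambda>\<omega>. X' \<omega> + Y' \<omega>)) | X' Y'. X' \<in> L2 M \<and> Y' \<in> L2 M \<and>
      same_distr M X' (\<lambda>_. 0) \<and> same_distr M Y' (\<lambda>_. 0)} \<le> ereal (\<rho> (\<lambda>_. 0))"
    by (intro Sup_least) (elim CollectE exE conjE, simp)
  then have "\<rho> (\<lambda>_. 0) + \<rho> (\<lambda>_. 0) \<le> \<rho> (\<lambda>_. 0)"
    unfolding neutral[OF L2_const L2_const, symmetric] by simp
  moreover have "\<rho> (\<lambda>_. 0) \<le> \<rho> (\<lambda>_. 0) + \<rho> (\<lambda>_. 0)"
    using subadditive[OF L2_const L2_const, of 0 0] by simp
  ultimately show ?thesis by simp
qed

text \<open>In neutrality against 0, the set under the supremum depends on \<open>X\<close> only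
  through its law.\<close>

lemma law_invariant:
  assumes X: "X \<in> L2 M" and Y: "Y \<in> L2 M" and XY: "same_distr M X Y"
  shows "\<rho> X = \<rho> Y"
proof -
  have "ereal (\<rho> X + \<rho> (\<lambda>_. 0)) = ereal (\<rho> Y + \<rho> (\<lambda>_. 0))"
    using XY unfolding neutral[OF X L2_const] neutral[OF Y L2_const] same_distr_def by (simp only:)
  then show ?thesis by simp
qed

text \<open>On \<open>[0, 1]\<close>, convexity gives \<open>\<rho> (t X) \<le> t \<rho> X\<close> and \<open>\<rho> ((1 - t) X) \<le> (1 - t) \<rho> X\<close>;
  by subadditivity both are equalities.\<close>

lemma homogeneous:
  assumes X: "X \<in> L2 M" and t: "0 \<le> t"
  shows "\<rho> (\<lambda>\<omega>. t *\<^sub>R X \<omega>) = t * \<rho> X"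
proof -
  have unit: "\<rho> (\<lambda>\<omega>. t *\<^sub>R X \<omega>) = t * \<rho> X" if X: "X \<in> L2 M" and t: "0 \<le> t" "t \<le> 1" for X t
  proof -
    have "\<rho> (\<lambda>\<omega>. s *\<^sub>R X \<omega>) \<le> s * \<rho> X" if "0 \<le> s" "s \<le> 1" for s
      using convex[OF L2_const[of 0] X that] by (simp add: zero)
    from this[of t] this[of "1 - t"]
    have "\<rho> (\<lambda>\<omega>. t *\<^sub>R X \<omega>) \<le> t * \<rho> X" "\<rho> (\<lambda>\<omega>. (1 - t) *\<^sub>R X \<omega>) \<le> (1 - t) * \<rho> X"
      using t by auto
    moreover have "\<rho> X \<le> \<rho> (\<lambda>\<omega>. t *\<^sub>R X \<omega>) + \<rho> (\<lambda>\<omega>. (1 - t) *\<^sub>R X \<omega>)"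
      using subadditive[OF L2_scaleR[OF X] L2_scaleR[OF X], of t "1 - t"]
      by (simp flip: scaleR_add_left)
    ultimately show ?thesis by (simp add: left_diff_distrib)
  qed
  show ?thesis
  proof (cases "t \<le> 1")
    case False
    then show ?thesis using unit[OF L2_scaleR[OF X, of t], of "1 / t"] by simp
  qed (use unit X t in simp)
qed

section \<open>The Lipschitz constant of the functional\<close>

text \<open>This is the \<open>K\<close> of the overview and the least Lipschitz constant of
  \<open>\<rho>\<close>. It is a supremum because attainment comes only with
  \<open>exists_maximiser\<close>.\<close>

definition gain :: real where
  "gain = (SUP X\<in>{X \<in> L2 M. L2_norm M X \<le> 1}. \<rho> X)"

text \<open>Continuity at 0 bounds \<open>\<rho>\<close> on a small ball, and homogeneity scales
  this bound up. The factor \<open>\<delta> / 2\<close> keeps scaled vectors strictly inside the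
  ball.\<close>

lemma bdd_above_unit_ball: "bdd_above (\<rho> ` {X \<in> L2 M. L2_norm M X \<le> 1})"
proof -
  have cont: "L2_continuous M \<rho>" using coherent by (simp add: strongly_coherent_def)
  have "\<exists>\<delta>>0. \<forall>Y\<in>L2 M. L2_norm M (\<lambda>\<omega>. Y \<omega> - 0) < \<delta> \<longrightarrow> \<bar>\<rho> Y - \<rho> (\<lambda>_. 0)\<bar> < 1"
    by (rule cont[unfolded L2_continuous_def, rule_format, OF L2_const zero_less_one])
  then obtain \<delta> where \<delta>: "0 < \<delta>" "\<And>Y. Y \<in> L2 M \<Longrightarrow> L2_norm M Y < \<delta> \<Longrightarrow> \<rho> Y < 1"
    by (auto simp: zero abs_less_iff)
  have "\<rho> X \<le> 2 / \<delta>" if X: "X \<in> L2 M" "L2_norm M X \<le> 1" for X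
  proof -
    have "\<delta> / 2 * L2_norm M X \<le> \<delta> / 2 * 1" using X \<delta> by (intro mult_left_mono) auto
    then have "L2_norm M (\<lambda>\<omega>. (\<delta> / 2) *\<^sub>R X \<omega>) < \<delta>"
      using \<delta>(1) by (simp add: L2_norm_scaleR)
    then have "\<rho> (\<lambda>\<omega>. (\<delta> / 2) *\<^sub>R X \<omega>) < 1"
      by (rule \<delta>(2)[OF L2_scaleR[OF X(1)]])
    then show ?thesis
      using homogeneous[OF X(1), of "\<delta> / 2"] \<delta>(1) by (simp add: field_simps)
  qed
  then show ?thesis by (intro bdd_aboveI2) auto
qed

lemma le_gain_unit: "X \<in> L2 M \<Longrightarrow> L2_norm M X \<le> 1 \<Longrightarrow> \<rho> X \<le> gain"
  unfolding gain_def by (rule cSUP_upper[OF _ bdd_above_unit_ball]) simp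

lemma gain_nonneg: "0 \<le> gain"
  using le_gain_unit[OF L2_const[of 0]] by (simp add: zero L2_norm_def)

lemma le_gain:
  assumes X: "X \<in> L2 M"
  shows "\<rho> X \<le> gain * L2_norm M X"
proof (rule field_le_epsilon)
  fix e :: real assume e: "0 < e"
  \<comment> \<open>The norm is enlarged so that a null \<open>X\<close> can be normalised as well;
    the enlargement costs \<open>e * (gain / (gain + 1))\<close>, at most \<open>e\<close>.\<close>
  define c where "c = L2_norm M X + e / (gain + 1)"
  have "0 < e / (gain + 1)" using e gain_nonneg by simp
  then have c: "L2_norm M X \<le> c" "0 < c"
    using L2_norm_nonneg[of M X] unfolding c_def by linarith+
  have "\<rho> (\<lambda>\<omega>. (1 / c) *\<^sub>R X \<omega>) \<le> gain"
    using c by (intro le_gain_unit L2_scaleR X) (simp add: L2_norm_scaleR)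
  then have "\<rho> X \<le> gain * c"
    using homogeneous[OF X, of "1 / c"] c by (simp add: field_simps)
  also have "\<dots> = gain * L2_norm M X + e * (gain / (gain + 1))"
    by (simp add: c_def algebra_simps)
  also have "e * (gain / (gain + 1)) \<le> e * 1"
    using e gain_nonneg by (intro mult_left_mono) auto
  finally show "\<rho> X \<le> gain * L2_norm M X + e" by simp
qed

lemma lipschitz:
  assumes X: "X \<in> L2 M" and Y: "Y \<in> L2 M"
  shows "\<rho> X \<le> \<rho> Y + gain * L2_norm M (\<lambda>\<omega>. X \<omega> - Y \<omega>)"
  using subadditive[OF Y L2_diff[OF X Y]] le_gain[OF L2_diff[OF X Y]] by simp

section \<open>Neutrality with one summand fixed, and attainment of the gain\<close>

text \<open>Neutrality moves both summands. A nearly optimal pair is transported so that its first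
  member becomes the given \<open>X\<close>; this costs one error for near-optimality and two for
  the rounded sums.\<close>

lemma neutral_fixed:
  assumes X: "X \<in> L2 M" and Y: "Y \<in> L2 M" and e: "0 < e"
  shows "\<exists>Y'\<in>L2 M. same_distr M Y' Y \<and> \<rho> X + \<rho> Y - e \<le> \<rho> (\<lambda>\<omega>. X \<omega> + Y' \<omega>)"
proof -
  define \<delta> where "\<delta> = e / 3 / (gain + 1)"
  have g: "0 < gain + 1" using gain_nonneg by simp
  then have \<delta>: "0 < \<delta>" using e by (simp add: \<delta>_def)
  have "gain * \<delta> \<le> (gain + 1) * \<delta>" using \<delta> by simp
  also have "\<dots> = e / 3"
    using g unfolding \<delta>_def by (metis less_irrefl mult.commute nonzero_divide_eq_eq)
  finally have gd: "gain * \<delta> \<le> e / 3" .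
  have "ereal (\<rho> X + \<rho> Y - e / 3) < ereal (\<rho> X + \<rho> Y)" using e by simp
  then obtain X1 Y1 where 1: "X1 \<in> L2 M" "Y1 \<in> L2 M" "same_distr M X1 X" "same_distr M Y1 Y"
    "\<rho> X + \<rho> Y - e / 3 < \<rho> (\<lambda>\<omega>. X1 \<omega> + Y1 \<omega>)"
    unfolding neutral[OF X Y] less_Sup_iff by auto
  obtain Y' Z Z' where Y': "Y' \<in> L2 M" "same_distr M Y' Y1" and Z: "Z \<in> L2 M" "Z' \<in> L2 M" "same_distr M Z' Z"
    "L2_norm M (\<lambda>\<omega>. Z \<omega> - (X1 \<omega> + Y1 \<omega>)) \<le> \<delta>" "L2_norm M (\<lambda>\<omega>. Z' \<omega> - (X \<omega> + Y' \<omega>)) \<le> \<delta>"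
    using exists_coupled_sum[OF 1(1) X same_distr_sym[OF 1(3)] 1(2) \<delta>] by blast
  have small: "gain * L2_norm M W \<le> e / 3" if "L2_norm M W \<le> \<delta>" for W :: "'a \<Rightarrow> 'b"
    using mult_left_mono[OF that gain_nonneg] gd by simp
  have "\<rho> (\<lambda>\<omega>. X1 \<omega> + Y1 \<omega>) \<le> \<rho> Z + e / 3"
    using lipschitz[OF L2_add[OF 1(1,2)] Z(1)] small[OF Z(4)]
    by (simp add: L2_norm_minus_commute[of M Z])
  moreover have "\<rho> Z = \<rho> Z'" using law_invariant[OF Z(2,1,3)] by simp
  moreover have "\<rho> Z' \<le> \<rho> (\<lambda>\<omega>. X \<omega> + Y' \<omega>) + e / 3"
    using lipschitz[OF Z(2) L2_add[OF X Y'(1)]] small[OF Z(5)] by simp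
  ultimately show ?thesis
    using Y' 1(4,5) by (intro bexI[of _ Y']) (auto intro: same_distr_trans)
qed

text \<open>Among near-maximisers in the unit ball, neutrality selects \<open>Y'\<close> with \<open>\<parallel>X + Y'\<parallel>\<close> close to \<open>2\<close>,
  so \<open>Y'\<close> is close to \<open>X\<close> by the parallelogram law.\<close>

lemma near_maximisers_close:
  assumes X: "X \<in> L2 M" "L2_norm M X \<le> 1" "gain * (1 - d) \<le> \<rho> X"
    and Y: "Y \<in> L2 M" "L2_norm M Y \<le> 1" "gain * (1 - d) \<le> \<rho> Y"
    and gain: "0 < gain" and d: "0 < d" "d \<le> 1 / 2"
  shows "\<exists>Y'\<in>L2 M. same_distr M Y' Y \<and> (L2_norm M (\<lambda>\<omega>. Y' \<omega> - X \<omega>))\<^sup>2 \<le> 12 * d"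
proof -
  obtain Y' where Y': "Y' \<in> L2 M" "same_distr M Y' Y" "\<rho> X + \<rho> Y - gain * d \<le> \<rho> (\<lambda>\<omega>. X \<omega> + Y' \<omega>)"
    using neutral_fixed[OF X(1) Y(1), of "gain * d"] gain d by auto
  have nY': "L2_norm M Y' \<le> 1"
    using same_distr_L2_norm[OF Y'(2) L2_measurable[OF Y'(1)] L2_measurable[OF Y(1)]] Y(2) by simp
  \<comment> \<open>Three losses of size \<open>gain * d\<close>: one each from \<open>X\<close> and
    \<open>Y\<close>, one from neutrality. The bound \<open>d \<le> 1 / 2\<close> keeps
    \<open>2 - 3 * d\<close> nonnegative for the squaring below.\<close>
  have "gain * (2 - 3 * d) \<le> gain * L2_norm M (\<lambda>\<omega>. X \<omega> + Y' \<omega>)"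
    using le_gain[OF L2_add[OF X(1) Y'(1)]] Y'(3) X(3) Y(3) by (simp add: algebra_simps)
  then have "2 - 3 * d \<le> L2_norm M (\<lambda>\<omega>. X \<omega> + Y' \<omega>)" using gain by simp
  then have "(2 - 3 * d)\<^sup>2 \<le> (L2_norm M (\<lambda>\<omega>. X \<omega> + Y' \<omega>))\<^sup>2"
    using d by (intro power_mono) auto
  \<comment> \<open>The squared norms of sum and difference add up to at most 4, which leaves at
    most \<open>12 * d\<close> for the difference.\<close>
  moreover have "4 - 12 * d \<le> (2 - 3 * d)\<^sup>2" by (simp add: power2_diff)
  moreover have "(L2_norm M X)\<^sup>2 \<le> 1" "(L2_norm M Y')\<^sup>2 \<le> 1"
    using X(2) nY' by (auto intro: power_le_one)
  ultimately have "(L2_norm M (\<lambda>\<omega>. Y' \<omega> - X \<omega>))\<^sup>2 \<le> 12 * d"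
    unfolding L2_norm_add_power2[OF X(1) Y'(1)] L2_norm_diff_power2[OF Y'(1) X(1)]
    by (simp add: L2_inner_commute[of M Y' X])
  then show ?thesis using Y' by blast
qed

lemma exists_maximiser:
  assumes gain: "0 < gain"
  shows "\<exists>U\<in>L2 M. L2_norm M U \<le> 1 \<and> \<rho> U = gain"
proof -
  \<comment> \<open>Chosen so that \<open>12 * d n\<close> is the square of
    \<open>(1 / 2) ^ n\<close>, the rate that \<open>L2_complete\<close> expects.\<close>
  define d :: "nat \<Rightarrow> real" where "d n = (1 / 4) ^ n / 12" for n
  have d: "0 < d n" "d n \<le> 1 / 2" "d (Suc n) \<le> d n" for n
    using power_le_one[of "1/4::real" n] by (auto simp: d_def)
  define P where "P n X \<longleftrightarrow> X \<in> L2 M \<and> L2_norm M X \<le> 1 \<and> gain * (1 - d n) \<le> \<rho> X"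
    for n and X :: "'a \<Rightarrow> 'b"
  have ex: "\<exists>X. P n X" for n
  proof -
    have "gain * (1 - d n) < gain * 1" using d(1)[of n] gain by (intro mult_strict_left_mono) auto
    then have "gain * (1 - d n) < (SUP X\<in>{X \<in> L2 M. L2_norm M X \<le> 1}. \<rho> X)"
      by (simp add: gain_def)
    moreover have "(\<lambda>_. 0) \<in> {X \<in> L2 M. L2_norm M (X :: 'a \<Rightarrow> 'b) \<le> 1}"
      using L2_const[of "0::'b"] by (simp add: L2_norm_def)
    ultimately obtain X where "X \<in> L2 M" "L2_norm M X \<le> 1" "gain * (1 - d n) < \<rho> X"
      using less_cSUP_iff[OF _ bdd_above_unit_ball] by blast
    then show ?thesis by (auto simp: P_def)
  qed
  have "\<exists>u. \<forall>n. P n (u n) \<and> L2_norm M (\<lambda>\<omega>. u (Suc n) \<omega> - u n \<omega>) \<le> (1 / 2) ^ n"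
  proof (rule dependent_nat_choice)
    fix X n assume "P n X"
    then have X: "X \<in> L2 M" "L2_norm M X \<le> 1" "gain * (1 - d n) \<le> \<rho> X" by (auto simp: P_def)
    \<comment> \<open>\<open>Y\<close> has the finer quality \<open>Suc n\<close>, and its copy
      keeps it; for the distance to \<open>X\<close> it is used only with quality
      \<open>n\<close>.\<close>
    obtain Y where PY: "P (Suc n) Y" using ex by blast
    then have Y: "Y \<in> L2 M" "L2_norm M Y \<le> 1" "gain * (1 - d n) \<le> \<rho> Y"
      using order_trans[OF mult_left_mono[OF _ gain_nonneg], of "1 - d n" "1 - d (Suc n)" "\<rho> Y"] d(3)[of n]
      by (auto simp: P_def)
    obtain Y' where Y': "Y' \<in> L2 M" "same_distr M Y' Y" "(L2_norm M (\<lambda>\<omega>. Y' \<omega> - X \<omega>))\<^sup>2 \<le> 12 * d n"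
      using near_maximisers_close[OF X Y gain d(1,2)] by blast
    have "((1 / 2) ^ n)\<^sup>2 = ((1 / 2)\<^sup>2 :: real) ^ n" by (metis power_mult mult.commute)
    also have "(1 / 2 :: real)\<^sup>2 = 1 / 4" by (simp add: power2_eq_square)
    also have "(1 / 4) ^ n = 12 * d n" by (simp add: d_def)
    finally have "(L2_norm M (\<lambda>\<omega>. Y' \<omega> - X \<omega>))\<^sup>2 \<le> ((1 / 2) ^ n)\<^sup>2"
      using Y'(3) by (simp only:)
    then have "L2_norm M (\<lambda>\<omega>. Y' \<omega> - X \<omega>) \<le> (1 / 2) ^ n"
      by (rule power2_le_imp_le) simp
    moreover have "P (Suc n) Y'"
      using PY Y' law_invariant[OF Y'(1) Y(1) Y'(2)]
        same_distr_L2_norm[OF Y'(2) L2_measurable[OF Y'(1)] L2_measurable[OF Y(1)]]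
      by (simp add: P_def)
    ultimately show "\<exists>Y. P (Suc n) Y \<and> L2_norm M (\<lambda>\<omega>. Y \<omega> - X \<omega>) \<le> (1 / 2) ^ n" by blast
  qed (rule ex)
  then obtain u where u: "\<And>n. u n \<in> L2 M" "\<And>n. L2_norm M (u n) \<le> 1" "\<And>n. gain * (1 - d n) \<le> \<rho> (u n)"
    "\<And>n. L2_norm M (\<lambda>\<omega>. u (Suc n) \<omega> - u n \<omega>) \<le> (1 / 2) ^ n"
    by (auto simp: P_def)
  obtain U where U: "U \<in> L2 M" "\<And>n. L2_norm M (\<lambda>\<omega>. u n \<omega> - U \<omega>) \<le> 2 * (1 / 2) ^ n"
    using L2_complete[of u, OF u(1,4)] by blast
  have "L2_norm M U \<le> 1 + 2 * (1 / 2) ^ n" for n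
    using L2_norm_triangle[OF u(1)[of n] L2_diff[OF U(1) u(1)[of n]]] u(2)[of n] U(2)[of n]
    by (simp add: L2_norm_minus_commute[of M U])
  moreover have "(\<lambda>n. 1 + 2 * (1 / 2) ^ n :: real) \<longlonglongrightarrow> 1" by real_asymp
  ultimately have nU: "L2_norm M U \<le> 1" by (intro LIMSEQ_le_const) auto
  have "gain * (1 - d n) \<le> \<rho> U + gain * (2 * (1 / 2) ^ n)" for n
    using lipschitz[OF u(1)[of n] U(1)] u(3)[of n] mult_left_mono[OF U(2)[of n] gain_nonneg] by simp
  then have "gain * (1 - d n) - gain * (2 * (1 / 2) ^ n) \<le> \<rho> U" for n
    by (simp add: diff_le_eq)
  moreover have "(\<lambda>n. gain * (1 - d n) - gain * (2 * (1 / 2) ^ n)) \<longlonglongrightarrow> gain * (1 - 0 / 12) - gain * (2 * 0)"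
    unfolding d_def by (intro tendsto_intros LIMSEQ_power_zero) auto
  ultimately have "gain * (1 - 0 / 12) - gain * (2 * 0) \<le> \<rho> U" by (intro LIMSEQ_le_const2) auto
  then have "gain \<le> \<rho> U" by simp
  then show ?thesis using le_gain_unit[OF U(1) nU] U(1) nU by (intro bexI[of _ U]) auto
qed

text \<open>At a maximiser \<open>U\<close>, \<open>\<rho> (U + Y) \<le> gain * \<parallel>U + Y\<parallel> \<le> gain * (1 + \<parallel>U + Y\<parallel>\<^sup>2) / 2\<close> is an upper
  bound whose first-order part in \<open>Y\<close> is \<open>gain * \<langle>U, Y\<rangle>\<close>.\<close>

lemma exists_gradient:
  "\<exists>U\<in>L2 M. (\<forall>X\<in>L2 M. L2_inner M U X \<le> \<rho> X) \<and>
    (\<forall>X\<in>L2 M. \<forall>e>0. \<exists>X'\<in>L2 M. same_distr M X' X \<and> \<rho> X - e \<le> L2_inner M U X')"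
proof (cases "gain = 0")
  case True
  have "\<rho> X = 0" if X: "X \<in> L2 M" for X
  proof -
    \<comment> \<open>With zero gain \<open>\<rho>\<close> is nowhere positive, and subadditivity at
      \<open>X\<close> and \<open>- X\<close> leaves only the value 0; the gradient is then
      0.\<close>
    have X': "(\<lambda>\<omega>. (-1) *\<^sub>R X \<omega>) \<in> L2 M" by (rule L2_scaleR[OF X])
    show ?thesis using subadditive[OF X X'] le_gain[OF X] le_gain[OF X'] by (simp add: zero True)
  qed
  then show ?thesis
    by (intro bexI[of _ "\<lambda>_. 0"] L2_const) (auto simp: L2_inner_def same_distr_def)
next
  case False
  then have gain: "0 < gain" using gain_nonneg by simp
  obtain U where U: "U \<in> L2 M" "L2_norm M U \<le> 1" "\<rho> U = gain"
    using exists_maximiser[OF gain] by blast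
  have upper: "\<rho> (\<lambda>\<omega>. U \<omega> + Y \<omega>) \<le> gain + gain * L2_inner M U Y + gain * (L2_norm M Y)\<^sup>2 / 2"
    if Y: "Y \<in> L2 M" for Y
  proof -
    let ?a = "L2_norm M (\<lambda>\<omega>. U \<omega> + Y \<omega>)"
    have "0 \<le> (?a - 1)\<^sup>2" by simp
    then have "?a \<le> (1 + ?a\<^sup>2) / 2" by (simp add: power2_diff)
    also have "?a\<^sup>2 \<le> 1 + 2 * L2_inner M U Y + (L2_norm M Y)\<^sup>2"
      unfolding L2_norm_add_power2[OF U(1) Y] using U(2) by (simp add: power_le_one)
    finally have "?a \<le> 1 + L2_inner M U Y + (L2_norm M Y)\<^sup>2 / 2" by simp
    from mult_left_mono[OF this gain_nonneg] le_gain[OF L2_add[OF U(1) Y]] show ?thesis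
      by (simp add: algebra_simps)
  qed
  have lower: "gain * L2_inner M U X \<le> \<rho> X" if X: "X \<in> L2 M" for X
  proof (rule field_le_epsilon)
    fix e :: real assume e: "0 < e"
    \<comment> \<open>This size makes the second-order term at most \<open>e / 2\<close> after
      division by \<open>s\<close>.\<close>
    define s where "s = e / (gain * (L2_norm M X)\<^sup>2 + 1)"
    have den: "0 < gain * (L2_norm M X)\<^sup>2 + 1" using gain_nonneg by (simp add: add_nonneg_pos)
    then have s: "0 < s" using e by (simp add: s_def)
    \<comment> \<open>The perturbation goes in direction \<open>- X\<close>: splitting
      \<open>U\<close> as \<open>(U - s X) + s X\<close> turns the upper bound at
      \<open>U - s X\<close> into a lower bound for \<open>\<rho> X\<close>.\<close>
    have "gain \<le> \<rho> (\<lambda>\<omega>. U \<omega> + (- s) *\<^sub>R X \<omega>) + s * \<rho> X"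
      using subadditive[OF L2_add[OF U(1) L2_scaleR[OF X, of "-s"]] L2_scaleR[OF X, of s]]
        homogeneous[OF X, of s] s U(3) by simp
    then have "s * (gain * L2_inner M U X) \<le> s * (\<rho> X + s * (gain * (L2_norm M X)\<^sup>2) / 2)"
      using upper[OF L2_scaleR[OF X, of "-s"]]
      unfolding L2_inner_scaleR_right L2_norm_scaleR
      by (simp add: L2_inner_scaleR_right L2_norm_scaleR power_mult_distrib power2_eq_square algebra_simps)
    then have "gain * L2_inner M U X \<le> \<rho> X + s * (gain * (L2_norm M X)\<^sup>2) / 2" using s by simp
    also have "s * (gain * (L2_norm M X)\<^sup>2) \<le> s * (gain * (L2_norm M X)\<^sup>2 + 1)" using s by simp
    also have "\<dots> = e" using den by (simp add: s_def)
    finally show "gain * L2_inner M U X \<le> \<rho> X + e" using e by simp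
  qed
  have attain: "\<exists>X'\<in>L2 M. same_distr M X' X \<and> \<rho> X - e \<le> gain * L2_inner M U X'"
    if X: "X \<in> L2 M" and e: "0 < e" for X e
  proof -
    define s where "s = e / (gain * (L2_norm M X)\<^sup>2 + 1)"
    have den: "0 < gain * (L2_norm M X)\<^sup>2 + 1" using gain_nonneg by (simp add: add_nonneg_pos)
    then have s: "0 < s" using e by (simp add: s_def)
    \<comment> \<open>The tolerance is proportional to \<open>s\<close>, so that an error of only
      \<open>e / 2\<close> remains after division by \<open>s\<close>.\<close>
    obtain Y where Y: "Y \<in> L2 M" "same_distr M Y (\<lambda>\<omega>. s *\<^sub>R X \<omega>)"
      "\<rho> U + \<rho> (\<lambda>\<omega>. s *\<^sub>R X \<omega>) - s * (e / 2) \<le> \<rho> (\<lambda>\<omega>. U \<omega> + Y \<omega>)"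
      using neutral_fixed[OF U(1) L2_scaleR[OF X, of s], of "s * (e / 2)"] e s by auto
    define X' where "X' \<omega> = (1 / s) *\<^sub>R Y \<omega>" for \<omega>
    have X': "X' \<in> L2 M" unfolding X'_def by (rule L2_scaleR[OF Y(1)])
    have Y_eq: "Y = (\<lambda>\<omega>. s *\<^sub>R X' \<omega>)" using s by (simp add: X'_def)
    have "same_distr M X' X"
      using same_distr_compose[OF Y(2) L2_measurable[OF Y(1)] L2_measurable[OF L2_scaleR[OF X]], of "\<lambda>x. (1 / s) *\<^sub>R x"] s
      by (simp add: X'_def[abs_def])
    have nX': "L2_norm M X' = L2_norm M X"
      using same_distr_L2_norm[OF \<open>same_distr M X' X\<close> L2_measurable[OF X'] L2_measurable[OF X]] .
    have "s * (\<rho> X - e / 2) \<le> s * (gain * L2_inner M U X' + s * (gain * (L2_norm M X)\<^sup>2) / 2)"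
      using upper[OF Y(1)] Y(3) homogeneous[OF X, of s] s U(3) nX'
      by (simp add: Y_eq L2_inner_scaleR_right L2_norm_scaleR power_mult_distrib power2_eq_square algebra_simps)
    then have "\<rho> X - e / 2 \<le> gain * L2_inner M U X' + s * (gain * (L2_norm M X)\<^sup>2) / 2" using s by simp
    also have "s * (gain * (L2_norm M X)\<^sup>2) \<le> s * (gain * (L2_norm M X)\<^sup>2 + 1)" using s by simp
    also have "\<dots> = e" using den by (simp add: s_def)
    finally have "\<rho> X - e \<le> gain * L2_inner M U X'" by simp
    with X' \<open>same_distr M X' X\<close> show ?thesis by blast
  qed
  show ?thesis
    using lower attain by (intro bexI[OF _ L2_scaleR[OF U(1), of gain]]) (auto simp: L2_inner_scaleR_left)
qed

text \<open>The gradient property keeps \<open>U\<close> fixed and varies the copies of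
  \<open>X\<close>, while \<open>max_correlation\<close> keeps \<open>X\<close> fixed and varies the
  copies of \<open>U\<close>. The coupling \<open>exists_coupled_inner\<close> exchanges the two
  roles in both inequalities.\<close>

lemma is_max_correlation: "\<exists>\<mu>\<in>P2. \<forall>X\<in>L2 M. ereal (\<rho> X) = max_correlation M \<mu> X"
proof -
  obtain U where U: "U \<in> L2 M" "\<And>X. X \<in> L2 M \<Longrightarrow> L2_inner M U X \<le> \<rho> X"
    "\<And>X e. X \<in> L2 M \<Longrightarrow> 0 < e \<Longrightarrow> \<exists>X'\<in>L2 M. same_distr M X' X \<and> \<rho> X - e \<le> L2_inner M U X'"
    using exists_gradient by blast
  note [measurable] = U(1)[THEN L2_measurable]
  show ?thesis
  proof (intro bexI ballI antisym)
    show "distr M borel U \<in> P2"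
      using U(1) by (auto simp: P2_def L2_def integrable_distr_eq intro!: prob_space_distr)
    fix X :: "'a \<Rightarrow> 'b" assume X: "X \<in> L2 M"
    show "max_correlation M (distr M borel U) X \<le> ereal (\<rho> X)"
      unfolding max_correlation_def
    proof (rule Sup_least, elim CollectE exE conjE)
      fix z V assume z: "z = ereal (\<integral>\<omega>. X \<omega> \<bullet> V \<omega> \<partial>M)" and V: "V \<in> L2 M" "distr M borel V = distr M borel U"
      have "L2_inner M V X \<le> \<rho> X"
      proof (rule field_le_epsilon)
        fix e :: real assume "0 < e"
        moreover have "same_distr M U V" using V by (simp add: same_distr_def)
        ultimately obtain X' where X': "X' \<in> L2 M" "same_distr M X' X" "L2_inner M V X - e \<le> L2_inner M U X'"
          using exists_coupled_inner[OF V(1) U(1) _ X] by blast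
        then show "L2_inner M V X \<le> \<rho> X + e"
          using U(2)[OF X'(1)] law_invariant[OF X'(1) X X'(2)] by simp
      qed
      then show "z \<le> ereal (\<rho> X)" by (simp add: z L2_inner_def inner_commute)
    qed
    show "ereal (\<rho> X) \<le> max_correlation M (distr M borel U) X"
    proof (rule ereal_le_epsilon2)
      fix e :: real assume e: "0 < e"
      obtain X' where X': "X' \<in> L2 M" "same_distr M X' X" "\<rho> X - e / 2 \<le> L2_inner M U X'"
        using U(3)[OF X, of "e / 2"] e by auto
      obtain V where V: "V \<in> L2 M" "same_distr M V U" "L2_inner M X' U - e / 2 \<le> L2_inner M X V"
        using exists_coupled_inner[OF X'(1) X same_distr_sym[OF X'(2)] U(1), of "e / 2"] e by auto
      have "ereal (\<rho> X) \<le> ereal (L2_inner M X V) + ereal e"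
        using X'(3) V(3) by (simp add: L2_inner_commute[of M X' U])
      also have "\<dots> \<le> max_correlation M (distr M borel U) X + ereal e"
        unfolding max_correlation_def L2_inner_def using V
        by (intro add_right_mono Sup_upper) (auto simp: same_distr_def)
      finally show "ereal (\<rho> X) \<le> max_correlation M (distr M borel U) X + ereal e" .
    qed
  qed
qed

end

theorem theorem1:
  fixes M :: "'a measure" and \<rho> :: "('a \<Rightarrow> real ^ 'n) \<Rightarrow> real"
  assumes "prob_space M"
    and "\<nexists>A. is_atom M A"
    and "L2_separable M"
    and "L2_functional M \<rho>"
  shows "strongly_coherent M \<rho> \<longleftrightarrow>
    (\<exists>\<mu>\<in>P2. \<forall>X\<in>L2 M. ereal (\<rho> X) = max_correlation M \<mu> X)"
proof -
  interpret atomless_prob_space M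
    using assms(1,2) by (simp add: atomless_prob_space_def atomless_prob_space_axioms_def)
  show ?thesis
  proof
    assume "strongly_coherent M \<rho>"
    then interpret strongly_coherent_risk M \<rho>
      using assms(4) by unfold_locales
    show "\<exists>\<mu>\<in>P2. \<forall>X\<in>L2 M. ereal (\<rho> X) = max_correlation M \<mu> X"
      by (rule is_max_correlation)
  qed (auto intro: max_correlation_strongly_coherent)
qed

end
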